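(* Let $F$ be a singular fiber of Kodaira type $II^*$ of an elliptic fibration on a smooth $K3$ surface, written $$F=6C+3S_1+4M_1+2M_2+5L_1+4L_2+3L_3+2L_4+L_5.$$ Let $R$ be an ADER in $F$ with $C\subset\operatorname{Supp}(R)$. Let $\Gamma$ be the connected component of $R$ containing $C$, and write $$\Gamma=C+S_1+\cdots+S_\alpha+M_1+\cdots+M_\beta+L_1+\cdots+L_\gamma$$ with $\alpha\in\{0,1\}$, $\beta\in\{0,1,2\}$, $\gamma\in\{0,1,2,3,4,5\}$ (terms being omitted when the corresponding integer is $0$), and $R=\Gamma+R_M^{\mathrm{tail}}+R_L^{\mathrm{tail}}$, where $R_M^{\mathrm{tail}}$ and $R_L^{\mathrm{tail}}$ are the remaining parts of $R$ supported on the $M$- and $L$-branches. Then $(\alpha,\beta,\gamma)$ satisfies one of the following conditions. (1) At most two of $\alpha,\beta,\gamma$ are nonzero. In this case $\Gamma$ is of type $A_{1+\alpha+\beta+\gamma}$. (2) The three integers $\alpha,\beta,\gamma$ are all nonzero. Then $\alpha=1$ and $(\beta,\gamma)\neq(2,5)$, and the type of $\Gamma$ is as follows: (a) if $\beta=1$, then $\Gamma$ is of type $D_{\gamma+3}$; (b) if $(\beta,\gamma)=(2,1)$, then $\Gamma$ is of type $D_5$; (c) if $(\beta,\gamma)=(2,2)$, then $\Gamma$ is of type $E_6$; (d) if $(\beta,\gamma)=(2,3)$, then $\Gamma$ is of type $E_7$; (e) if $(\beta,\gamma)=(2,4)$, then $\Gamma$ is of type $E_8$. Moreover, $R_M^{\mathrm{tail}}=0$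 if $\beta\geq1$; if $\beta=0$, then $R_M^{\mathrm{tail}}$ is either zero or equal to $M_2$, and in the latter case it is of type $A_1$. The divisor $R_L^{\mathrm{tail}}$ is either zero or a disjoint union of mutually disjoint consecutive subchains of $L_{\gamma+2}-L_{\gamma+3}-\cdots-L_5$ if $\gamma\leq3$, and it is zero if $\gamma\geq4$. If $R_L^{\mathrm{tail}}\neq0$, then it is of type $A_{\lambda_1}\oplus\cdots\oplus A_{\lambda_b}$ for some $\lambda_1,\dots,\lambda_b\geq1$ satisfying $$\sum_{j=1}^b\lambda_j+b-1\leq4-\gamma.$$ Conversely, every reduced subdivisor of $F$ of the form $\Gamma+R_M^{\mathrm{tail}}+R_L^{\mathrm{tail}}$ is an ADER, where $\Gamma=C+S_1+\cdots+S_\alpha+M_1+\cdots+M_\beta+L_1+\cdots+L_\gamma$ with $\alpha\in\{0,1\}$, $\beta\in\{0,1,2\}$, $\gamma\in\{0,\dots,5\}$ and $(\alpha,\beta,\gamma)\neq(1,2,5)$; $R_M^{\mathrm{tail}}=0$ if $\beta\geq1$ and $R_M^{\mathrm{tail}}\in\{0,M_2\}$ if $\beta=0$; and $R_L^{\mathrm{tail}}$ is zero or, if $\gamma\leq3$, possibly a disjoint union of mutually disjoint consecutive subchains of $L_{\gamma+2}-\cdots-L_5$, of type $A_{\lambda_1}\oplus\cdots\oplus A_{\lambda_b}$ with $\sum_{j=1}^b\lambda_j+b-1\leq4-\gamma$.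
   Context: We work over an algebraically closed field of characteristic $0$. In a fiber of type $II^*$ all components are smooth rational $(-2)$-curves, meeting transversely in at most one point, with dual graph $\widetilde E_8$: the central vertex $C$ is the unique component meeting three others, and three branches start at $C$: $C-S_1$, $C-M_1-M_2$, and $C-L_1-L_2-L_3-L_4-L_5$. Since $\Gamma$ is connected and contains $C$, it meets each branch in an initial segment, so $\alpha,\beta,\gamma$ are well defined. An ADE reduced divisor (ADER) in $F$ is a reduced subdivisor of $F$ (a sum of distinct components) whose dual graph is a disjoint union of Dynkin diagrams of type $A_k$, $D_l$ ($l\ge4$), $E_6,E_7,E_8$; its type is the type of this graph, with $\oplus$ denoting disjoint union. Mutually disjoint consecutive subchains are pairwise separated by at least one unused vertex. *)

theory Defs
  imports Main "HOL-Library.Poly_Mapping"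
begin

section \<open>Simple graphs and Dynkin types\<close>

record 'a graph =
  verts :: "'a set"
  edges :: "'a set set"

definition graph_iso :: "'a graph \<Rightarrow> 'b graph \<Rightarrow> bool" where
  "graph_iso G H \<longleftrightarrow>
     (\<exists>f. bij_betw f (verts G) (verts H) \<and> edges H = (\<lambda>e. f ` e) ` edges G)"

definition connected_component :: "'a graph \<Rightarrow> 'a \<Rightarrow> 'a set" where
  "connected_component G x = {y \<in> verts G. (x, y) \<in> {(u, v). {u, v} \<in> edges G}\<^sup>*}"

datatype dynkin = DynA nat | DynD nat | DynE6 | DynE7 | DynE8

fun valid_dynkin :: "dynkin \<Rightarrow> bool" where
  "valid_dynkin (DynA k) \<longleftrightarrow> k \<ge> 1"
| "valid_dynkin (DynD l) \<longleftrightarrow> l \<ge> 4"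
| "valid_dynkin DynE6 \<longleftrightarrow> True"
| "valid_dynkin DynE7 \<longleftrightarrow> True"
| "valid_dynkin DynE8 \<longleftrightarrow> True"

text \<open>The vertex labels \<open>1, \<dots>, n\<close> follow Bourbaki.\<close>

definition E_graph :: "nat \<Rightarrow> nat graph" where
  "E_graph n =
     \<lparr>verts = {1..n}, edges = {{1, 3}, {2, 4}} \<union> {{i, i + 1} | i. 3 \<le> i \<and> i + 1 \<le> n}\<rparr>"

fun dynkin_graph :: "dynkin \<Rightarrow> nat graph" where
  "dynkin_graph (DynA k) = \<lparr>verts = {1..k}, edges = {{i, i + 1} | i. 1 \<le> i \<and> i + 1 \<le> k}\<rparr>"
| "dynkin_graph (DynD l) =
     \<lparr>verts = {1..l}, edges = insert {l - 2, l} {{i, i + 1} | i. 1 \<le> i \<and> i + 1 \<le> l - 1}\<rparr>"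
| "dynkin_graph DynE6 = E_graph 6"
| "dynkin_graph DynE7 = E_graph 7"
| "dynkin_graph DynE8 = E_graph 8"

text \<open>A list \<open>[t\<^sub>1, \<dots>, t\<^sub>b]\<close> stands for \<open>t\<^sub>1 \<oplus> \<dots> \<oplus> t\<^sub>b\<close>; the empty list is the type of the
  empty graph. Types are unordered: a graph of type \<open>ts\<close> has every permutation of \<open>ts\<close> as a
  type, too.\<close>

definition dynkin_sum_graph :: "dynkin list \<Rightarrow> (nat \<times> nat) graph" where
  "dynkin_sum_graph ts =
     \<lparr>verts = (SIGMA i:{..<length ts}. verts (dynkin_graph (ts ! i))),
      edges = (\<Union>i<length ts. (\<lambda>e. Pair i ` e) ` edges (dynkin_graph (ts ! i)))\<rparr>"

definition graph_of_type :: "'a graph \<Rightarrow> dynkin list \<Rightarrow> bool" where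
  "graph_of_type G ts \<longleftrightarrow> (\<forall>t\<in>set ts. valid_dynkin t) \<and> graph_iso G (dynkin_sum_graph ts)"


section \<open>Divisors and dual graphs\<close>

text \<open>\<open>'c\<close> is the type of irreducible curves on a smooth surface, and a divisor is a finite
  integral combination of them. The geometry enters only through the intersection numbers
  \<open>ip X Y = (X.Y)\<close> of curves (\<open>ip X X\<close> being the self-intersection number).\<close>

type_synonym 'c divisor = "'c \<Rightarrow>\<^sub>0 int"

abbreviation prime_div :: "'c \<Rightarrow> 'c divisor" where
  "prime_div X \<equiv> Poly_Mapping.single X 1"

abbreviation Supp :: "'c divisor \<Rightarrow> 'c set" where
  "Supp \<equiv> Poly_Mapping.keys"

definition reduced_subdivisor :: "'c divisor \<Rightarrow> 'c divisor \<Rightarrow> bool" where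
  "reduced_subdivisor F R \<longleftrightarrow> (\<exists>K \<subseteq> Supp F. R = (\<Sum>X\<in>K. prime_div X))"

text \<open>Two distinct curves meet iff their intersection number is nonzero. In the fibers below this
  number is at most 1, so the dual graph has no multiple edges.\<close>

definition dual_graph :: "('c \<Rightarrow> 'c \<Rightarrow> int) \<Rightarrow> 'c divisor \<Rightarrow> 'c graph" where
  "dual_graph ip R =
     \<lparr>verts = Supp R,
      edges = {{X, Y} | X Y. X \<in> Supp R \<and> Y \<in> Supp R \<and> X \<noteq> Y \<and> ip X Y \<noteq> 0}\<rparr>"

definition of_type :: "('c \<Rightarrow> 'c \<Rightarrow> int) \<Rightarrow> 'c divisor \<Rightarrow> dynkin list \<Rightarrow> bool" where
  "of_type ip R ts \<longleftrightarrow> graph_of_type (dual_graph ip R) ts"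

definition ADER :: "('c \<Rightarrow> 'c \<Rightarrow> int) \<Rightarrow> 'c divisor \<Rightarrow> 'c divisor \<Rightarrow> bool" where
  "ADER ip F R \<longleftrightarrow> reduced_subdivisor F R \<and> (\<exists>ts. of_type ip R ts)"

definition component_through :: "('c \<Rightarrow> 'c \<Rightarrow> int) \<Rightarrow> 'c divisor \<Rightarrow> 'c \<Rightarrow> 'c divisor" where
  "component_through ip R X = (\<Sum>Y\<in>connected_component (dual_graph ip R) X. prime_div Y)"


section \<open>Fibers of type \<open>II\<^sup>*\<close>\<close>

text \<open>All components are \<open>(-2)\<close>-curves (on a K3 surface: smooth rational curves, by adjunction).
  Distinct components meet transversely in at most one point, that is, \<open>(X.Y) \<in> {0, 1}\<close>; the edge
  set is that of the extended Dynkin diagram of \<open>E\<^sub>8\<close>.\<close>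

definition fiber_II_star ::
  "('c \<Rightarrow> 'c \<Rightarrow> int) \<Rightarrow> 'c divisor \<Rightarrow> 'c \<Rightarrow> (nat \<Rightarrow> 'c) \<Rightarrow> (nat \<Rightarrow> 'c) \<Rightarrow> (nat \<Rightarrow> 'c) \<Rightarrow> bool" where
  "fiber_II_star ip F C S M L \<longleftrightarrow>
     distinct [C, S 1, M 1, M 2, L 1, L 2, L 3, L 4, L 5] \<and>
     F = Poly_Mapping.single C 6 + Poly_Mapping.single (S 1) 3
         + Poly_Mapping.single (M 1) 4 + Poly_Mapping.single (M 2) 2
         + Poly_Mapping.single (L 1) 5 + Poly_Mapping.single (L 2) 4
         + Poly_Mapping.single (L 3) 3 + Poly_Mapping.single (L 4) 2
         + Poly_Mapping.single (L 5) 1 \<and>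
     (\<forall>X\<in>Supp F. ip X X = -2) \<and>
     (\<forall>X\<in>Supp F. \<forall>Y\<in>Supp F. ip X Y = ip Y X) \<and>
     (\<forall>X\<in>Supp F. \<forall>Y\<in>Supp F. X \<noteq> Y \<longrightarrow> ip X Y \<in> {0, 1}) \<and>
     edges (dual_graph ip F) =
       {{C, S 1},
        {C, M 1}, {M 1, M 2},
        {C, L 1}, {L 1, L 2}, {L 2, L 3}, {L 3, L 4}, {L 4, L 5}}"

definition Gamma_div ::
  "'c \<Rightarrow> (nat \<Rightarrow> 'c) \<Rightarrow> (nat \<Rightarrow> 'c) \<Rightarrow> (nat \<Rightarrow> 'c) \<Rightarrow> nat \<Rightarrow> nat \<Rightarrow> nat \<Rightarrow> 'c divisor" where
  "Gamma_div C S M L \<alpha> \<beta> \<gamma> =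
     prime_div C + (\<Sum>i=1..\<alpha>. prime_div (S i)) + (\<Sum>i=1..\<beta>. prime_div (M i))
       + (\<Sum>i=1..\<gamma>. prime_div (L i))"

text \<open>The support conditions together with \<open>R = \<Gamma> + RM + RL\<close> determine \<open>RM\<close> and \<open>RL\<close> as the parts
  of \<open>R - \<Gamma>\<close> on the two branches.\<close>

definition ader_decomposition ::
  "('c \<Rightarrow> 'c \<Rightarrow> int) \<Rightarrow> 'c \<Rightarrow> (nat \<Rightarrow> 'c) \<Rightarrow> (nat \<Rightarrow> 'c) \<Rightarrow> (nat \<Rightarrow> 'c) \<Rightarrow> 'c divisor \<Rightarrow>
   nat \<Rightarrow> nat \<Rightarrow> nat \<Rightarrow> 'c divisor \<Rightarrow> 'c divisor \<Rightarrow> bool" where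
  "ader_decomposition ip C S M L R \<alpha> \<beta> \<gamma> RM RL \<longleftrightarrow>
     \<alpha> \<in> {0, 1} \<and> \<beta> \<in> {0, 1, 2} \<and> \<gamma> \<in> {0, 1, 2, 3, 4, 5} \<and>
     component_through ip R C = Gamma_div C S M L \<alpha> \<beta> \<gamma> \<and>
     R = Gamma_div C S M L \<alpha> \<beta> \<gamma> + RM + RL \<and>
     Supp RM \<subseteq> M ` {1..2} \<and> Supp RL \<subseteq> L ` {1..5}"

text \<open>\<open>D\<close> is a disjoint union of mutually disjoint consecutive subchains of \<open>L\<^sub>m - \<dots> - L\<^sub>n\<close>. The
  pair \<open>(a, b)\<close> encodes the subchain \<open>L\<^sub>a - \<dots> - L\<^sub>b\<close>; any two subchains are separated by at least
  one unused vertex.\<close>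

definition union_of_subchains :: "(nat \<Rightarrow> 'c) \<Rightarrow> nat \<Rightarrow> nat \<Rightarrow> 'c divisor \<Rightarrow> bool" where
  "union_of_subchains L m n D \<longleftrightarrow>
     (\<exists>cs. (\<forall>(a, b)\<in>set cs. m \<le> a \<and> a \<le> b \<and> b \<le> n) \<and>
           (\<forall>j<length cs. \<forall>k<length cs. j \<noteq> k \<longrightarrow>
              snd (cs ! j) + 1 < fst (cs ! k) \<or> snd (cs ! k) + 1 < fst (cs ! j)) \<and>
           D = (\<Sum>(a, b)\<leftarrow>cs. \<Sum>i=a..b. prime_div (L i)))"

definition bounded_A_type :: "('c \<Rightarrow> 'c \<Rightarrow> int) \<Rightarrow> 'c divisor \<Rightarrow> nat \<Rightarrow> bool" where
  "bounded_A_type ip D \<gamma> \<longleftrightarrow>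
     (\<exists>ls. (\<forall>l\<in>set ls. l \<ge> 1) \<and> of_type ip D (map DynA ls) \<and>
           int (sum_list ls) + int (length ls) - 1 \<le> 4 - int \<gamma>)"

end

theory Submission imports Defs begin

text \<open>The dual graph of the fiber is Bourbaki's \<open>E\<close>-diagram on nine vertices, so divisors become sets
  of labels in \<open>{1..9}\<close>. The component of \<open>C\<close> ends on each branch at the first missing vertex, and
  whatever lies beyond is a subset of a chain, hence a union of maximal intervals. The only
  excluded triple is \<open>(1, 2, 5)\<close>, the whole fiber: its graph is connected with nine vertices, so it
  could only be of type \<open>A\<^sub>9\<close> or \<open>D\<^sub>9\<close>, and both fail near the trivalent vertex.\<close>

text \<open>The bound on the L-tail is a count: \<open>L (\<gamma> + 2)\<close> to
  \<open>L 5\<close> are 4 - \<gamma> curves, and b separated subchains use up at least b - 1 of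
  them as gaps. Charging every subchain one gap, the last one a fictitious vertex beyond the end of
  the chain, turns this into an estimate that an induction on the chain can carry. The obstacle on
  the other side is that a type is a list of diagrams up to isomorphism. To exhibit types,
  isomorphisms are built summand by summand and glued along sets of curves that do not meet. To
  refute a type of the whole fiber, a single summand must be extracted from an arbitrary list before
  vertices can be counted. In the converse, the L-tail is given merely as a divisor. That it is a
  reduced divisor on labels is recovered from the reducedness of \<open>R\<close>, because the
  supports of the three summands are disjoint.\<close>

section \<open>Graph isomorphisms and Dynkin types\<close>

text \<open>Isomorphisms are easiest to write as parametrizations of the curves by the vertices of a
  model diagram, the direction opposite to \<open>graph_iso\<close>. The record type does not force
  edges to consist of vertices, and \<open>inv_into\<close> cancels only on
  \<open>verts H\<close>.\<close>

lemma graph_iso_inverse: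
  assumes g: "bij_betw g (verts H) (verts G)"
    and edges: "edges G = (`) g ` edges H"
    and sub: "edges H \<subseteq> Pow (verts H)"
  shows "graph_iso G H"
proof -
  let ?f = "inv_into (verts H) g"
  have "?f ` (g ` e) = e" if "e \<in> edges H" for e
    using that sub g by (intro inv_into_image_cancel) (auto simp: bij_betw_def)
  then have "edges H = (\<lambda>e. ?f ` e) ` edges G"
    unfolding edges image_image by auto
  then show ?thesis
    unfolding graph_iso_def using bij_betw_inv_into[OF g] by blast
qed

lemma dynkin_graph_finite: "finite (verts (dynkin_graph t))"
  by (cases t) (auto simp: E_graph_def)

text \<open>Validity matters: for \<open>DynD l\<close> with \<open>l\<close> at most 2, truncated
  subtraction puts the non-vertex 0 into an edge. Ordered endpoints let later adjacency checks be
  restricted to \<open>i < j\<close>.\<close>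

lemma dynkin_graph_edge:
  assumes "valid_dynkin t" "e \<in> edges (dynkin_graph t)"
  obtains i j where "i < j" "i \<in> verts (dynkin_graph t)" "j \<in> verts (dynkin_graph t)" "e = {i, j}"
proof -
  have E: "\<exists>i j. i < j \<and> i \<in> {1..n} \<and> j \<in> {1..n} \<and> e = {i, j}"
    if "e \<in> edges (E_graph n)" "4 \<le> n" for n
  proof -
    from that consider "e = {1, 3}" | "e = {2, 4}" | i where "e = {i, i + 1}" "3 \<le> i" "i + 1 \<le> n"
      by (auto simp: E_graph_def)
    then show ?thesis
    proof cases
      case 1
      with that show ?thesis by (intro exI[of _ 1] exI[of _ 3]) auto
    next
      case 2
      with that show ?thesis by (intro exI[of _ 2] exI[of _ 4]) auto
    next
      case (3 i)
      then show ?thesis by (intro exI[of _ i] exI[of _ "i + 1"]) auto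
    qed
  qed
  have "\<exists>i j. i < j \<and> i \<in> verts (dynkin_graph t) \<and> j \<in> verts (dynkin_graph t) \<and> e = {i, j}"
  proof (cases t)
    case (DynA k)
    then obtain i where "e = {i, i + 1}" "1 \<le> i" "i + 1 \<le> k" using assms by auto
    with DynA show ?thesis by (intro exI[of _ i] exI[of _ "i + 1"]) auto
  next
    case (DynD l)
    then consider "e = {l - 2, l}" | i where "e = {i, i + 1}" "1 \<le> i" "i + 1 \<le> l - 1"
      using assms by auto
    then show ?thesis
    proof cases
      case 1
      with assms DynD show ?thesis by (intro exI[of _ "l - 2"] exI[of _ l]) auto
    next
      case (2 i)
      with assms DynD show ?thesis by (intro exI[of _ i] exI[of _ "i + 1"]) auto
    qed
  next
    case DynE6
    with assms E[of 6] show ?thesis by (simp add: E_graph_def)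
  next
    case DynE7
    with assms E[of 7] show ?thesis by (simp add: E_graph_def)
  next
    case DynE8
    with assms E[of 8] show ?thesis by (simp add: E_graph_def)
  qed
  then show thesis using that by blast
qed

text \<open>The first coordinate in \<open>dynkin_sum_graph\<close> numbers the summands, so those
  of \<open>us\<close> are moved past \<open>ts\<close> by \<open>shift\<close> and the two
  isomorphisms are glued. Disjoint vertex sets make the glued map agree with each part, and edges
  inside the vertex sets transfer this agreement to edges.\<close>

lemma graph_of_type_append:
  assumes "graph_of_type G ts" "graph_of_type H us"
    and disj: "verts G \<inter> verts H = {}"
    and sub: "edges G \<subseteq> Pow (verts G)" "edges H \<subseteq> Pow (verts H)"
  shows "graph_of_type \<lparr>verts = verts G \<union> verts H, edges = edges G \<union> edges H\<rparr> (ts @ us)"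
proof -
  define shift where "shift = (\<lambda>(i, x :: nat). (i + length ts, x))"
  define T U where "T = dynkin_sum_graph ts" and "U = dynkin_sum_graph us"
  obtain f where f: "bij_betw f (verts G) (verts T)" "edges T = (\<lambda>e. f ` e) ` edges G"
    using assms(1) unfolding graph_of_type_def graph_iso_def T_def by metis
  obtain g where g: "bij_betw g (verts H) (verts U)" "edges U = (\<lambda>e. g ` e) ` edges H"
    using assms(2) unfolding graph_of_type_def graph_iso_def U_def by metis
  have shift_mem: "(i, x) \<in> shift ` A \<longleftrightarrow> length ts \<le> i \<and> (i - length ts, x) \<in> A" for i x A
  proof
    assume "length ts \<le> i \<and> (i - length ts, x) \<in> A"
    then show "(i, x) \<in> shift ` A"
      by (intro image_eqI[of _ _ "(i - length ts, x)"]) (auto simp: shift_def)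
  qed (auto simp: shift_def)
  have verts: "verts (dynkin_sum_graph (ts @ us)) = verts T \<union> shift ` verts U"
  proof (rule set_eqI)
    fix z :: "nat \<times> nat"
    obtain i x where z: "z = (i, x)" by fastforce
    show "z \<in> verts (dynkin_sum_graph (ts @ us)) \<longleftrightarrow> z \<in> verts T \<union> shift ` verts U"
      unfolding z Un_iff shift_mem
      by (cases "i < length ts") (auto simp: T_def U_def dynkin_sum_graph_def nth_append)
  qed
  have split: "{..<length (ts @ us)} = {..<length ts} \<union> (\<lambda>i. i + length ts) ` {..<length us}"
    by (simp add: lessThan_atLeast0 image_add_atLeastLessThan' add.commute ivl_disj_un_two(3))
  have "(\<lambda>e. shift ` e) ` (\<lambda>e. Pair i ` e) ` E = (\<lambda>e. Pair (i + length ts) ` e) ` E" for i E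
    by (simp add: image_image shift_def)
  then have edges: "edges (dynkin_sum_graph (ts @ us)) = edges T \<union> (`) shift ` edges U"
    unfolding T_def U_def dynkin_sum_graph_def split by (simp add: UN_Un image_UN nth_append)
  have disj': "verts T \<inter> shift ` verts U = {}"
    unfolding T_def U_def dynkin_sum_graph_def shift_def by auto
  have "inj shift" unfolding shift_def by (rule injI) auto
  then have sg: "bij_betw (shift \<circ> g) (verts H) (shift ` verts U)"
    by (intro bij_betw_trans[OF g(1)] inj_on_imp_bij_betw) (rule inj_on_subset, auto)
  define h where "h = (\<lambda>x. if x \<in> verts G then f x else shift (g x))"
  have hG: "bij_betw h (verts G) (verts T)"
    using f(1) by (rule bij_betw_cong[THEN iffD1, rotated]) (simp add: h_def)
  have hH: "bij_betw h (verts H) (shift ` verts U)"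
    using sg by (rule bij_betw_cong[THEN iffD1, rotated]) (use disj in \<open>auto simp: h_def\<close>)
  have "h ` e = f ` e" if "e \<in> edges G" for e
    using that sub by (intro image_cong) (auto simp: h_def)
  moreover have "h x = shift (g x)" if "x \<in> verts H" for x
    using that disj by (auto simp: h_def)
  then have "h ` e = shift ` g ` e" if "e \<in> edges H" for e
    unfolding image_image using that sub by (intro image_cong) blast+
  ultimately have "edges (dynkin_sum_graph (ts @ us)) = (\<lambda>e. h ` e) ` (edges G \<union> edges H)"
    unfolding edges f(2) g(2) image_Un image_image by simp
  moreover have "bij_betw h (verts G \<union> verts H) (verts (dynkin_sum_graph (ts @ us)))"
    unfolding verts by (rule bij_betw_combine[OF hG hH disj'])
  ultimately show ?thesis
    using assms(1,2) unfolding graph_of_type_def graph_iso_def by auto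
qed

section \<open>Reduced divisors\<close>

text \<open>The common shape of the sums in \<open>reduced_subdivisor\<close> and
  \<open>component_through\<close>. On finite sets it is injective, which turns equations between
  divisors into equations between sets.\<close>

definition reduced_div :: "'c set \<Rightarrow> 'c divisor" where
  "reduced_div K = (\<Sum>X\<in>K. prime_div X)"

lemma lookup_reduced_div:
  "finite K \<Longrightarrow> Poly_Mapping.lookup (reduced_div K) X = (if X \<in> K then 1 else 0)"
  by (simp add: reduced_div_def lookup_sum lookup_single when_def)

lemma Supp_reduced_div: "finite K \<Longrightarrow> Supp (reduced_div K) = K"
  by (auto simp: in_keys_iff lookup_reduced_div split: if_splits)

lemma reduced_div_empty [simp]: "reduced_div {} = 0"
  by (simp add: reduced_div_def)

lemma reduced_div_Un:
  "\<lbrakk>finite A; finite B; A \<inter> B = {}\<rbrakk> \<Longrightarrow> reduced_div (A \<union> B) = reduced_div A + reduced_div B"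
  by (simp add: reduced_div_def sum.union_disjoint)

lemma reduced_div_inject:
  "\<lbrakk>finite A; finite B\<rbrakk> \<Longrightarrow> reduced_div A = reduced_div B \<longleftrightarrow> A = B"
  by (metis Supp_reduced_div)

lemma reduced_div_image:
  "inj_on f I \<Longrightarrow> reduced_div (f ` I) = (\<Sum>i\<in>I. prime_div (f i))"
  by (simp add: reduced_div_def sum.reindex)

lemma dual_graph_reduced_div:
  "finite K \<Longrightarrow> dual_graph ip (reduced_div K) =
     \<lparr>verts = K, edges = {{X, Y} | X Y. X \<in> K \<and> Y \<in> K \<and> X \<noteq> Y \<and> ip X Y \<noteq> 0}\<rparr>"
  by (simp add: dual_graph_def Supp_reduced_div)

lemma of_type_zero: "of_type ip 0 []"
  by (simp add: of_type_def graph_of_type_def graph_iso_def dual_graph_def dynkin_sum_graph_def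
      bij_betw_def)

lemma of_type_Un:
  assumes "of_type ip (reduced_div A) ts" "of_type ip (reduced_div B) us"
    and fin: "finite A" "finite B" and "A \<inter> B = {}"
    and "\<And>x y. \<lbrakk>x \<in> A; y \<in> B\<rbrakk> \<Longrightarrow> ip x y = 0 \<and> ip y x = 0"
  shows "of_type ip (reduced_div (A \<union> B)) (ts @ us)"
proof -
  let ?G = "\<lambda>K. dual_graph ip (reduced_div K)"
  have "?G (A \<union> B) = \<lparr>verts = verts (?G A) \<union> verts (?G B), edges = edges (?G A) \<union> edges (?G B)\<rparr>"
    using assms(6) by (auto simp: dual_graph_reduced_div fin)
  then show ?thesis
    using graph_of_type_append[of "?G A" ts "?G B" us] assms
    by (auto simp: of_type_def dual_graph_reduced_div)
qed

text \<open>Symmetry of \<open>ip\<close> on \<open>K\<close> and the ordered endpoints from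
  \<open>dynkin_graph_edge\<close> reduce the comparison of the two edge sets to pairs
  \<open>i < j\<close>.\<close>

lemma of_type_singleI:
  assumes t: "valid_dynkin t" and g: "bij_betw g (verts (dynkin_graph t)) K"
    and sym: "\<And>X Y. \<lbrakk>X \<in> K; Y \<in> K\<rbrakk> \<Longrightarrow> ip X Y = ip Y X"
    and adj: "\<And>i j. \<lbrakk>i \<in> verts (dynkin_graph t); j \<in> verts (dynkin_graph t); i < j\<rbrakk>
                \<Longrightarrow> ip (g i) (g j) \<noteq> 0 \<longleftrightarrow> {i, j} \<in> edges (dynkin_graph t)"
  shows "of_type ip (reduced_div K) [t]"
proof -
  let ?V = "verts (dynkin_graph t)"
  have K: "K = g ` ?V" and inj: "inj_on g ?V" using g by (auto simp: bij_betw_def)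
  have "finite K" unfolding K by (simp add: dynkin_graph_finite)
  note dual = dual_graph_reduced_div[OF this, of ip]
  have edges: "edges (dual_graph ip (reduced_div K)) = (`) g ` edges (dynkin_graph t)"
  proof (intro equalityI subsetI)
    fix e assume "e \<in> edges (dual_graph ip (reduced_div K))"
    then obtain i j where ij: "e = {g i, g j}" "i \<in> ?V" "j \<in> ?V" "i \<noteq> j" "ip (g i) (g j) \<noteq> 0"
      unfolding dual by (auto simp: K)
    have "{i, j} \<in> edges (dynkin_graph t)"
    proof (cases "i < j")
      case False
      then have "{j, i} \<in> edges (dynkin_graph t)"
        using ij sym[of "g i" "g j"] by (subst adj[symmetric]) (auto simp: K)
      then show ?thesis by (simp add: insert_commute)
    qed (use ij adj in auto)
    then show "e \<in> (`) g ` edges (dynkin_graph t)"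
      unfolding ij(1) by (intro image_eqI[of _ _ "{i, j}"]) auto
  next
    fix e assume "e \<in> (`) g ` edges (dynkin_graph t)"
    then obtain e' where e': "e = g ` e'" "e' \<in> edges (dynkin_graph t)" by blast
    from dynkin_graph_edge[OF t e'(2)] obtain i j
      where ij: "i < j" "i \<in> ?V" "j \<in> ?V" "e' = {i, j}" by blast
    then have "ip (g i) (g j) \<noteq> 0" "g i \<noteq> g j"
      using adj[of i j] e'(2) inj by (auto simp: inj_on_def)
    with ij e'(1) show "e \<in> edges (dual_graph ip (reduced_div K))"
      unfolding dual by (auto simp: K)
  qed
  let ?T = "dynkin_sum_graph [t]"
  have T: "verts ?T = Pair 0 ` ?V" "edges ?T = (`) (Pair 0) ` edges (dynkin_graph t)"
    by (auto simp: dynkin_sum_graph_def lessThan_Suc)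
  have sub: "edges (dynkin_graph t) \<subseteq> Pow ?V"
    using dynkin_graph_edge[OF t] by blast
  \<comment> \<open>In a one-element sum all vertices carry the index 0, which \<open>snd\<close>
    strips off.\<close>
  have "bij_betw (g \<circ> snd) (verts ?T) (verts (dual_graph ip (reduced_div K)))"
    unfolding dual T using inj by (auto simp: K bij_betw_def inj_on_def image_image)
  moreover have "edges (dual_graph ip (reduced_div K)) = (`) (g \<circ> snd) ` edges ?T"
    unfolding edges T by (simp add: image_image)
  moreover have "edges ?T \<subseteq> Pow (verts ?T)"
    unfolding T using sub by blast
  ultimately have "graph_iso (dual_graph ip (reduced_div K)) ?T"
    by (rule graph_iso_inverse)
  with t show ?thesis by (simp add: of_type_def graph_of_type_def)
qed

lemma of_type_chain:
  assumes inj: "inj_on p {a..b}" and "a \<le> b"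
    and sym: "\<And>i j. \<lbrakk>i \<in> {a..b}; j \<in> {a..b}\<rbrakk> \<Longrightarrow> ip (p i) (p j) = ip (p j) (p i)"
    and adj: "\<And>i j. \<lbrakk>i \<in> {a..b}; j \<in> {a..b}; i < j\<rbrakk> \<Longrightarrow> ip (p i) (p j) \<noteq> 0 \<longleftrightarrow> j = i + 1"
  shows "of_type ip (reduced_div (p ` {a..b})) [DynA (b + 1 - a)]"
proof (rule of_type_singleI)
  \<comment> \<open>Vertices of A-diagrams start at 1, chains at \<open>a\<close>. Adding before
    subtracting keeps the case \<open>a = 0\<close>, which does occur, free of truncation.\<close>
  let ?g = "\<lambda>i. p (i + a - 1)"
  have shift: "bij_betw (\<lambda>i. i + a - 1) {1..b + 1 - a} {a..b}"
    by (rule bij_betw_byWitness[where f' = "\<lambda>i. i + 1 - a"]) auto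
  have "bij_betw p {a..b} (p ` {a..b})"
    using inj by (simp add: bij_betw_def)
  from bij_betw_trans[OF shift this]
  show "bij_betw ?g (verts (dynkin_graph (DynA (b + 1 - a)))) (p ` {a..b})"
    by (simp add: comp_def)
  fix i j assume ij: "i \<in> verts (dynkin_graph (DynA (b + 1 - a)))"
    "j \<in> verts (dynkin_graph (DynA (b + 1 - a)))" "i < j"
  then have "ip (?g i) (?g j) \<noteq> 0 \<longleftrightarrow> j + a - 1 = i + a - 1 + 1"
    by (intro adj) auto
  also have "\<dots> \<longleftrightarrow> {i, j} \<in> edges (dynkin_graph (DynA (b + 1 - a)))"
    using ij by (auto simp: doubleton_eq_iff)
  finally show "ip (?g i) (?g j) \<noteq> 0 \<longleftrightarrow> {i, j} \<in> edges (dynkin_graph (DynA (b + 1 - a)))" .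
qed (use assms in auto)

section \<open>Subsets of a chain\<close>

text \<open>The maximal intervals are peeled off from the top, so the list is descending. Each
  interval is charged its length plus the gap below it; for the lowest one this gap may be a
  fictitious vertex below \<open>m\<close>, whence \<open>n + 1 - m\<close> instead of
  \<open>n - m\<close>. The half-open range admits the empty chain \<open>m = n\<close> as an end of
  the recursion.\<close>

lemma decompose_into_intervals:
  fixes J :: "nat set"
  assumes "m \<le> n" "J \<subseteq> {m..<n}"
  shows "\<exists>cs. (\<forall>(a, b)\<in>set cs. m \<le> a \<and> a \<le> b \<and> b < n) \<and>
              sorted_wrt (\<lambda>(a, b) (c, d). d + 1 < a) cs \<and>
              J = (\<Union>(a, b)\<in>set cs. {a..b}) \<and>
              (\<Sum>(a, b)\<leftarrow>cs. b + 1 - a) + length cs \<le> n + 1 - m"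
  using assms
proof (induction n arbitrary: J rule: less_induct)
  case (less n)
  \<comment> \<open>The full chain is separate because it has no missing vertex to recurse
    below.\<close>
  consider "J = {}" | "J \<noteq> {}" "n - 1 \<notin> J" | "n - 1 \<in> J" "J = {m..<n}" | "n - 1 \<in> J" "J \<noteq> {m..<n}"
    by blast
  then show ?case
  proof cases
    case 1
    then show ?thesis by (intro exI[of _ "[]"]) auto
  next
    case 2
    then have "m \<le> n - 1" "n - 1 < n" using less.prems by fastforce+
    moreover have "J \<subseteq> {m..<n - 1}"
    proof
      fix x assume "x \<in> J"
      moreover from this 2 have "x \<noteq> n - 1" by auto
      ultimately show "x \<in> {m..<n - 1}" using less.prems(2) by fastforce
    qed
    ultimately obtain cs where "\<forall>(a, b)\<in>set cs. m \<le> a \<and> a \<le> b \<and> b < n - 1"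
      "sorted_wrt (\<lambda>(a, b) (c, d). d + 1 < a) cs" "J = (\<Union>(a, b)\<in>set cs. {a..b})"
      "(\<Sum>(a, b)\<leftarrow>cs. b + 1 - a) + length cs \<le> n - 1 + 1 - m"
      using less.IH[of "n - 1" J] by blast
    then show ?thesis by (intro exI[of _ cs]) fastforce
  next
    case 3
    then show ?thesis using less.prems by (intro exI[of _ "[(m, n - 1)]"]) auto
  next
    case 4
    \<comment> \<open>Everything above the highest missing vertex \<open>c\<close> is the top
      interval. Recursing strictly below \<open>c\<close> keeps the remaining intervals separated
      from it.\<close>
    define c where "c = Max ({m..<n} - J)"
    have "{m..<n} - J \<noteq> {}" using 4 less.prems by auto
    then have c: "c \<in> {m..<n} - J" unfolding c_def by (intro Max_in) auto
    have above: "{c<..<n} \<subseteq> J"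
    proof
      fix x assume x: "x \<in> {c<..<n}"
      show "x \<in> J"
      proof (rule ccontr)
        assume "x \<notin> J"
        with x c have "x \<le> c" unfolding c_def by (intro Max_ge) auto
        with x show False by simp
      qed
    qed
    have "c \<noteq> n - 1" using c 4 by auto
    with c have c': "m \<le> c" "c < n - 1" "c \<notin> J" by auto
    then obtain cs where cs: "\<forall>(a, b)\<in>set cs. m \<le> a \<and> a \<le> b \<and> b < c"
      "sorted_wrt (\<lambda>(a, b) (c, d). d + 1 < a) cs" "J \<inter> {m..<c} = (\<Union>(a, b)\<in>set cs. {a..b})"
      "(\<Sum>(a, b)\<leftarrow>cs. b + 1 - a) + length cs \<le> c + 1 - m"
      using less.IH[of c "J \<inter> {m..<c}"] by fastforce
    have "J = {c + 1..n - 1} \<union> J \<inter> {m..<c}"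
    proof (intro equalityI subsetI)
      fix x assume "x \<in> J"
      moreover from this c' have "x \<noteq> c" by auto
      ultimately show "x \<in> {c + 1..n - 1} \<union> J \<inter> {m..<c}"
        using less.prems(2) by fastforce
    qed (use above c' in fastforce)
    then have "J = (\<Union>(a, b)\<in>set ((c + 1, n - 1) # cs). {a..b})"
      using cs(3) by simp
    then show ?thesis
      using cs c' by (intro exI[of _ "(c + 1, n - 1) # cs"]) fastforce
  qed
qed

text \<open>Separated intervals are disjoint, so no index is counted twice in the list sum.\<close>

lemma sum_over_intervals:
  fixes f :: "nat \<Rightarrow> 'b::comm_monoid_add"
  assumes "sorted_wrt (\<lambda>(a, b) (c, d). d + 1 < a) cs" "\<forall>(a, b)\<in>set cs. a \<le> b"
  shows "(\<Sum>(a, b)\<leftarrow>cs. \<Sum>i=a..b. f i) = sum f (\<Union>(a, b)\<in>set cs. {a..b})"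
  using assms
proof (induction cs)
  case (Cons c cs)
  obtain a b where c: "c = (a, b)" by fastforce
  have "{a..b} \<inter> (\<Union>(a, b)\<in>set cs. {a..b}) = {}"
    using Cons.prems(1) by (fastforce simp: c)
  then have "sum f (\<Union>(a, b)\<in>set (c # cs). {a..b}) = sum f {a..b} + sum f (\<Union>(a, b)\<in>set cs. {a..b})"
    by (simp add: c) (rule sum.union_disjoint, auto)
  with Cons c show ?case by simp
qed simp

lemma union_of_subchainsI:
  assumes "sorted_wrt (\<lambda>(a, b) (c, d). d + 1 < a) cs" "\<forall>(a, b)\<in>set cs. m \<le> a \<and> a \<le> b \<and> b \<le> n"
    and inj: "inj_on L {m..n}"
  shows "union_of_subchains L m n (reduced_div (L ` (\<Union>(a, b)\<in>set cs. {a..b})))"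
proof -
  \<comment> \<open>Sortedness speaks about positions \<open>j < k\<close>; the disjunction is
    symmetric and so covers both orders.\<close>
  have "snd (cs ! j) + 1 < fst (cs ! k) \<or> snd (cs ! k) + 1 < fst (cs ! j)"
    if "j < length cs" "k < length cs" "j \<noteq> k" for j k
    using assms(1) that unfolding sorted_wrt_iff_nth_less
    by (metis (mono_tags, lifting) case_prod_beta linorder_neqE_nat)
  moreover have "inj_on L (\<Union>(a, b)\<in>set cs. {a..b})"
    using assms(2) by (intro inj_on_subset[OF inj]) fastforce
  then have "reduced_div (L ` (\<Union>(a, b)\<in>set cs. {a..b})) = (\<Sum>(a, b)\<leftarrow>cs. \<Sum>i=a..b. prime_div (L i))"
    using assms by (subst sum_over_intervals) (auto simp: reduced_div_image)
  ultimately show ?thesis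
    unfolding union_of_subchains_def using assms(2) by blast
qed

text \<open>Adjacent indices differ by exactly 1, while indices from different intervals differ by
  more. Hence no edge crosses between summands and the A-types of the intervals are
  concatenated.\<close>

lemma of_type_intervals:
  assumes "sorted_wrt (\<lambda>(a, b) (c, d). d + 1 < a) cs" "\<forall>(a, b)\<in>set cs. m \<le> a \<and> a \<le> b \<and> b \<le> n"
    and inj: "inj_on L {m..n}"
    and sym: "\<And>i j. \<lbrakk>i \<in> {m..n}; j \<in> {m..n}\<rbrakk> \<Longrightarrow> ip (L i) (L j) = ip (L j) (L i)"
    and adj: "\<And>i j. \<lbrakk>i \<in> {m..n}; j \<in> {m..n}; i < j\<rbrakk> \<Longrightarrow> ip (L i) (L j) \<noteq> 0 \<longleftrightarrow> j = i + 1"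
  shows "of_type ip (reduced_div (L ` (\<Union>(a, b)\<in>set cs. {a..b})))
           (map DynA (map (\<lambda>(a, b). b + 1 - a) cs))"
  using assms(1,2)
proof (induction cs)
  case Nil
  show ?case by (simp add: of_type_zero)
next
  case (Cons c cs)
  obtain a b where c: "c = (a, b)" by fastforce
  with Cons.prems have ab: "m \<le> a" "a \<le> b" "b \<le> n" by auto
  let ?I = "\<Union>(a, b)\<in>set cs. {a..b}"
  have below: "y + 1 < x" "m \<le> y" if "x \<in> {a..b}" "y \<in> ?I" for x y
    using Cons.prems that by (fastforce simp: c)+
  have "of_type ip (reduced_div (L ` {a..b} \<union> L ` ?I))
          ([DynA (b + 1 - a)] @ map DynA (map (\<lambda>(a, b). b + 1 - a) cs))"
  proof (rule of_type_Un)
    show "of_type ip (reduced_div (L ` {a..b})) [DynA (b + 1 - a)]"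
      by (rule of_type_chain) (use ab sym adj in \<open>auto intro: inj_on_subset[OF inj]\<close>)
    show "of_type ip (reduced_div (L ` ?I)) (map DynA (map (\<lambda>(a, b). b + 1 - a) cs))"
      using Cons by simp
    show "L ` {a..b} \<inter> L ` ?I = {}"
    proof -
      have "?I \<subseteq> {m..n}" using Cons.prems by fastforce
      moreover have "{a..b} \<inter> ?I = {}" using below(1) by fastforce
      ultimately show ?thesis
        using inj_on_image_Int[OF inj, of "{a..b}" ?I] ab by simp
    qed
    fix X Y assume "X \<in> L ` {a..b}" "Y \<in> L ` ?I"
    then obtain x y where xy: "X = L x" "Y = L y" "x \<in> {a..b}" "y \<in> ?I" by blast
    with below[of x y] ab have "x \<in> {m..n}" "y \<in> {m..n}" "y + 1 < x" by auto
    then have "ip (L x) (L y) = ip (L y) (L x)" "ip (L y) (L x) = 0"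
      using sym adj[of y x] by auto
    with xy show "ip X Y = 0 \<and> ip Y X = 0" by simp
  qed auto
  then show ?case by (simp add: c image_Un)
qed

lemma Supp_union_of_subchains:
  assumes "union_of_subchains L m n D"
  shows "Supp D \<subseteq> L ` {m..n}"
proof -
  have "Supp (\<Sum>(a, b)\<leftarrow>cs. \<Sum>i=a..b. prime_div (L i)) \<subseteq> L ` {m..n}"
    if "\<forall>(a, b)\<in>set cs. m \<le> a \<and> a \<le> b \<and> b \<le> n" for cs
    using that
  proof (induction cs)
    case (Cons c cs)
    obtain a b where c: "c = (a, b)" by fastforce
    have "Supp (\<Sum>i=a..b. prime_div (L i)) \<subseteq> (\<Union>i\<in>{a..b}. Supp (prime_div (L i)))"
      by (rule Poly_Mapping.keys_sum)
    also have "\<dots> \<subseteq> L ` {m..n}"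
      using Cons.prems by (auto simp: c)
    finally have "Supp (\<Sum>i=a..b. prime_div (L i)) \<subseteq> L ` {m..n}" .
    with Cons show ?case
      by (simp add: c) (meson Poly_Mapping.keys_add Un_least order_trans)
  qed simp
  with assms show ?thesis by (auto simp: union_of_subchains_def)
qed

text \<open>On \<open>P\<close> the coefficients of \<open>B\<close> and \<open>B'\<close> vanish,
  off \<open>P\<close> those of \<open>A\<close> and \<open>A'\<close>. This recovers the two tails
  from their sum.\<close>

lemma add_eq_add_disjoint_Supp:
  fixes A A' B B' :: "'c divisor"
  assumes disj: "P \<inter> Q = {}" and sum: "A + B = A' + B'"
    and A: "Supp A \<subseteq> P" "Supp A' \<subseteq> P" and B: "Supp B \<subseteq> Q" "Supp B' \<subseteq> Q"
  shows "A = A' \<and> B = B'"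
proof -
  have "Poly_Mapping.lookup A X = Poly_Mapping.lookup A' X" for X
  proof (cases "X \<in> P")
    case True
    then have "X \<notin> Supp B" "X \<notin> Supp B'" using disj B by blast+
    moreover have "Poly_Mapping.lookup (A + B) X = Poly_Mapping.lookup (A' + B') X" using sum by simp
    ultimately show ?thesis by (simp add: lookup_add in_keys_iff)
  next
    case False
    then have "X \<notin> Supp A" "X \<notin> Supp A'" using A by blast+
    then show ?thesis by (simp add: in_keys_iff)
  qed
  then have "A = A'" by (rule poly_mapping_eqI)
  with sum show ?thesis by simp
qed

section \<open>Fibers of type \<open>II\<^sup>*\<close>\<close>

locale II_star_fiber =
  fixes ip :: "'c \<Rightarrow> 'c \<Rightarrow> int" and F :: "'c divisor"
    and C :: 'c and S M L :: "nat \<Rightarrow> 'c"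
  assumes fiber: "fiber_II_star ip F C S M L"
begin

text \<open>The labels extend Bourbaki's numbering of \<open>E\<^sub>8\<close>: the dual graph of the fiber becomes
  \<^term>\<open>E_graph 9\<close>, and the paper's \<open>C\<close> and \<open>L\<^sub>i\<close> become the vertices \<open>4\<close> and \<open>i + 4\<close>.\<close>

definition v :: "nat \<Rightarrow> 'c" where
  "v i = (if i = 1 then M 2 else if i = 2 then S 1 else if i = 3 then M 1
          else if i = 4 then C else L (i - 4))"

text \<open>Edges of \<open>E_graph 9\<close> with the smaller label on the left, to be symmetrised
  where used. The upper end 9 comes from the label sets, which lie in \<open>{1..9}\<close>.\<close>

definition adj :: "nat \<Rightarrow> nat \<Rightarrow> bool" where
  "adj i j \<longleftrightarrow> i = 1 \<and> j = 3 \<or> i = 2 \<and> j = 4 \<or> 3 \<le> i \<and> j = i + 1"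

lemma v_4: "v 4 = C"
  by (simp add: v_def)

lemma labels: "{1..9::nat} = {1, 2, 3, 4, 5, 6, 7, 8, 9}"
  by auto

lemma inj_v: "inj_on v {1..9}"
  using fiber unfolding fiber_II_star_def labels by (auto simp: v_def)

lemma Supp_F: "Supp F = v ` {1..9}"
proof -
  note F = fiber[unfolded fiber_II_star_def, THEN conjunct2, THEN conjunct1]
  have "v ` {1..9} = {C, S 1, M 1, M 2, L 1, L 2, L 3, L 4, L 5}"
    unfolding labels by (auto simp: v_def)
  moreover have "X \<in> Supp F \<longleftrightarrow> X \<in> {C, S 1, M 1, M 2, L 1, L 2, L 3, L 4, L 5}" for X
  proof
    assume "X \<in> Supp F"
    then show "X \<in> {C, S 1, M 1, M 2, L 1, L 2, L 3, L 4, L 5}"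
      by (rule contrapos_pp) (auto simp: F in_keys_iff lookup_add lookup_single)
  next
    assume X: "X \<in> {C, S 1, M 1, M 2, L 1, L 2, L 3, L 4, L 5}"
    \<comment> \<open>All multiplicities are positive, so nothing cancels: the term at
      \<open>X\<close> is positive and the others are nonnegative, whichever curve \<open>X\<close>
      is.\<close>
    have nonneg: "0 \<le> Poly_Mapping.lookup (Poly_Mapping.single Y k) X" if "0 \<le> k" for X Y :: 'c and k :: int
      using that by (simp add: lookup_single when_def)
    have "0 < Poly_Mapping.lookup F X"
      unfolding F lookup_add using X
      by (elim insertE) (simp_all add: add_nonneg_pos add_pos_nonneg add_nonneg_nonneg nonneg)
    then show "X \<in> Supp F" by (simp add: in_keys_iff)
  qed
  ultimately show ?thesis by blast
qed

lemma ip_sym: "\<lbrakk>i \<in> {1..9}; j \<in> {1..9}\<rbrakk> \<Longrightarrow> ip (v i) (v j) = ip (v j) (v i)"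
  using fiber unfolding fiber_II_star_def Supp_F by blast

text \<open>The prescribed edge set is the image under \<open>v\<close> of eight pairs of labels.
  Taking images under \<open>v\<close> is injective on subsets of \<open>{1..9}\<close>, so an edge
  can be tested on labels, where it is a finite check.\<close>

lemma ip_v:
  assumes "i \<in> {1..9}" "j \<in> {1..9}" "i \<noteq> j"
  shows "ip (v i) (v j) \<noteq> 0 \<longleftrightarrow> adj i j \<or> adj j i"
proof -
  let ?E = "{{4, 2}, {4, 3}, {3, 1}, {4, 5}, {5, 6}, {6, 7}, {7, 8}, {8, 9 :: nat}}"
  have "v i \<noteq> v j" using inj_v assms by (auto dest: inj_onD)
  moreover have "v i \<in> Supp F" "v j \<in> Supp F" using assms by (auto simp: Supp_F)
  moreover have "ip (v i) (v j) = ip (v j) (v i)" using ip_sym assms by blast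
  ultimately have "ip (v i) (v j) \<noteq> 0 \<longleftrightarrow> {v i, v j} \<in> edges (dual_graph ip F)"
    unfolding dual_graph_def by (simp add: doubleton_eq_iff) metis
  also have "edges (dual_graph ip F) = {{C, S 1}, {C, M 1}, {M 1, M 2},
      {C, L 1}, {L 1, L 2}, {L 2, L 3}, {L 3, L 4}, {L 4, L 5}}"
    using fiber unfolding fiber_II_star_def by (elim conjE)
  also have "\<dots> = (`) v ` ?E"
    by (simp add: v_def insert_commute)
  also have "{v i, v j} \<in> (`) v ` ?E \<longleftrightarrow> v ` {i, j} \<in> (`) v ` ?E" by simp
  also have "\<dots> \<longleftrightarrow> {i, j} \<in> ?E"
    by (rule inj_on_image_mem_iff[OF inj_on_image_Pow[OF inj_v]]) (use assms in auto)
  also have "\<dots> \<longleftrightarrow> adj i j \<or> adj j i"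
    using assms(1)[unfolded labels] assms(2)
    by (elim insertE emptyE) (auto simp: doubleton_eq_iff adj_def)
  finally show ?thesis .
qed

lemma finite_index: "J \<subseteq> {1..9} \<Longrightarrow> finite (v ` J)"
  by (meson finite_atLeastAtMost finite_imageI finite_subset)

lemma v_image_inject: "\<lbrakk>I \<subseteq> {1..9}; J \<subseteq> {1..9}\<rbrakk> \<Longrightarrow> v ` I = v ` J \<longleftrightarrow> I = J"
  by (rule inj_on_image_eq_iff[OF inj_v])

lemma v_mem_image: "\<lbrakk>i \<in> {1..9}; J \<subseteq> {1..9}\<rbrakk> \<Longrightarrow> v i \<in> v ` J \<longleftrightarrow> i \<in> J"
  by (rule inj_on_image_mem_iff[OF inj_v])

lemma reduced_subdivisor_iff:
  "reduced_subdivisor F R \<longleftrightarrow> (\<exists>J\<subseteq>{1..9}. R = reduced_div (v ` J))"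
  unfolding reduced_subdivisor_def Supp_F reduced_div_def by (auto simp: subset_image_iff)

lemma lookup_v:
  "\<lbrakk>i \<in> {1..9}; J \<subseteq> {1..9}\<rbrakk> \<Longrightarrow>
    Poly_Mapping.lookup (reduced_div (v ` J)) (v i) = (if i \<in> J then 1 else 0)"
  by (simp add: lookup_reduced_div finite_index v_mem_image)

lemma of_type_labels:
  assumes "valid_dynkin t" "bij_betw g (verts (dynkin_graph t)) I" "I \<subseteq> {1..9}"
    and "\<And>i j. \<lbrakk>i \<in> verts (dynkin_graph t); j \<in> verts (dynkin_graph t); i < j\<rbrakk>
           \<Longrightarrow> adj (g i) (g j) \<or> adj (g j) (g i) \<longleftrightarrow> {i, j} \<in> edges (dynkin_graph t)"
  shows "of_type ip (reduced_div (v ` I)) [t]"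
proof (rule of_type_singleI)
  have g: "g ` verts (dynkin_graph t) = I" "inj_on g (verts (dynkin_graph t))"
    using assms(2) by (auto simp: bij_betw_def)
  have "bij_betw v I (v ` I)"
    using inj_on_subset[OF inj_v assms(3)] by (simp add: bij_betw_def)
  from bij_betw_trans[OF assms(2) this]
  show "bij_betw (v \<circ> g) (verts (dynkin_graph t)) (v ` I)" .
  fix i j assume ij: "i \<in> verts (dynkin_graph t)" "j \<in> verts (dynkin_graph t)" "i < j"
  then have "g i \<noteq> g j" "g i \<in> {1..9}" "g j \<in> {1..9}"
    using g assms(3) by (auto dest: inj_onD)
  then show "ip ((v \<circ> g) i) ((v \<circ> g) j) \<noteq> 0 \<longleftrightarrow> {i, j} \<in> edges (dynkin_graph t)"
    using assms(4)[OF ij] by (simp add: ip_v)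
qed (use assms ip_sym in blast)+

lemma of_type_label_chain:
  assumes "inj_on q {a..b}" "a \<le> b" "q ` {a..b} \<subseteq> {1..9}"
    and "\<And>i j. \<lbrakk>i \<in> {a..b}; j \<in> {a..b}; i < j\<rbrakk>
           \<Longrightarrow> adj (q i) (q j) \<or> adj (q j) (q i) \<longleftrightarrow> j = i + 1"
  shows "of_type ip (reduced_div (v ` q ` {a..b})) [DynA (b + 1 - a)]"
  unfolding image_image
proof (rule of_type_chain)
  show "inj_on (\<lambda>i. v (q i)) {a..b}"
    using comp_inj_on[OF assms(1) inj_on_subset[OF inj_v assms(3)]] by (simp add: comp_def)
  fix i j assume "i \<in> {a..b}" "j \<in> {a..b}" "i < j"
  moreover from this have "q i \<noteq> q j" "q i \<in> {1..9}" "q j \<in> {1..9}"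
    using assms(1,3) by (auto dest: inj_onD simp del: atLeastAtMost_iff)
  ultimately show "ip (v (q i)) (v (q j)) \<noteq> 0 \<longleftrightarrow> j = i + 1"
    using assms(4) by (subst ip_v)
qed (use assms ip_sym in blast)+

subsection \<open>The component \<open>\<Gamma>\<close>\<close>

text \<open>Labels 3 and 1 are \<open>M 1\<close> and \<open>M 2\<close>, hence the thresholds 1 and
  2 on \<beta>. The comprehensions are empty or singletons, so membership unfolds to arithmetic
  without case splits.\<close>

definition Gamma_labels :: "nat \<Rightarrow> nat \<Rightarrow> nat \<Rightarrow> nat set" where
  "Gamma_labels \<alpha> \<beta> \<gamma> =
     {4..4 + \<gamma>} \<union> {i. i = 2 \<and> 1 \<le> \<alpha>} \<union> {i. i = 3 \<and> 1 \<le> \<beta>} \<union> {i. i = 1 \<and> 2 \<le> \<beta>}"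

lemma Gamma_labels_subset: "\<gamma> \<le> 5 \<Longrightarrow> Gamma_labels \<alpha> \<beta> \<gamma> \<subseteq> {1..9}"
  by (auto simp: Gamma_labels_def)

lemma Gamma_div_eq:
  assumes "\<alpha> \<le> 1" "\<beta> \<le> 2" "\<gamma> \<le> 5"
  shows "Gamma_div C S M L \<alpha> \<beta> \<gamma> = reduced_div (v ` Gamma_labels \<alpha> \<beta> \<gamma>)"
proof -
  let ?p = "\<lambda>i. prime_div (v i)"
  have L: "(\<Sum>i=1..\<gamma>. prime_div (L i)) = sum ?p {5..4 + \<gamma>}"
  proof -
    have "sum ?p {1 + 4..\<gamma> + 4} = (\<Sum>i=1..\<gamma>. ?p (i + 4))"
      by (rule sum.shift_bounds_cl_nat_ivl)
    also have "\<dots> = (\<Sum>i=1..\<gamma>. prime_div (L i))"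
      by (rule sum.cong) (auto simp: v_def)
    finally show ?thesis by (simp add: add.commute)
  qed
  have S: "(\<Sum>i=1..\<alpha>. prime_div (S i)) = sum ?p {i. i = 2 \<and> 1 \<le> \<alpha>}"
    using assms(1) by (cases "\<alpha> = 0") (auto simp: v_def le_Suc_eq)
  have "\<beta> = 0 \<or> \<beta> = 1 \<or> \<beta> = 2" using assms(2) by auto
  then have M: "(\<Sum>i=1..\<beta>. prime_div (M i)) = sum ?p ({i. i = 3 \<and> 1 \<le> \<beta>} \<union> {i. i = 1 \<and> 2 \<le> \<beta>})"
    by (elim disjE) (auto simp: v_def numeral_2_eq_2)
  have "Gamma_labels \<alpha> \<beta> \<gamma> = insert 4 ({i. i = 2 \<and> 1 \<le> \<alpha>} \<union>
      ({i. i = 3 \<and> 1 \<le> \<beta>} \<union> {i. i = 1 \<and> 2 \<le> \<beta>}) \<union> {5..4 + \<gamma>})"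
    by (auto simp: Gamma_labels_def)
  then have "sum ?p (Gamma_labels \<alpha> \<beta> \<gamma>) = ?p 4 + (sum ?p {i. i = 2 \<and> 1 \<le> \<alpha>} +
      sum ?p ({i. i = 3 \<and> 1 \<le> \<beta>} \<union> {i. i = 1 \<and> 2 \<le> \<beta>}) + sum ?p {5..4 + \<gamma>})"
    by (simp add: sum.union_disjoint disjoint_iff)
  then have "sum ?p (Gamma_labels \<alpha> \<beta> \<gamma>) = Gamma_div C S M L \<alpha> \<beta> \<gamma>"
    unfolding L[symmetric] S[symmetric] M[symmetric] by (simp add: Gamma_div_def v_def add.assoc)
  then show ?thesis
    using reduced_div_image[OF inj_on_subset[OF inj_v Gamma_labels_subset[OF assms(3)]]] by simp
qed

text \<open>With one branch absent, the other two and \<open>C\<close> lie on a path. Each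
  \<open>?q\<close> walks along that path through \<open>C\<close>, and an interval of positions
  cuts out \<Gamma>; a shorter left branch only raises the lower end.\<close>

lemma Gamma_type_A:
  assumes "\<alpha> \<le> 1" "\<beta> \<le> 2" "\<gamma> \<le> 5" "\<alpha> = 0 \<or> \<beta> = 0 \<or> \<gamma> = 0"
  shows "of_type ip (reduced_div (v ` Gamma_labels \<alpha> \<beta> \<gamma>)) [DynA (1 + \<alpha> + \<beta> + \<gamma>)]"
  using assms(4)
proof (elim disjE)
  assume 0: "\<alpha> = 0"
  \<comment> \<open>The path \<open>M 2\<close>, \<open>M 1\<close>, \<open>C\<close>,
    \<open>L 1\<close>, ... with \<open>C\<close> at position 2.\<close>
  let ?q = "\<lambda>i :: nat. if i = 0 then 1 else i + 2"
  have "?q ` {2 - \<beta>..2 + \<gamma>} = Gamma_labels \<alpha> \<beta> \<gamma>"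
  proof (intro equalityI subsetI)
    fix i assume "i \<in> Gamma_labels \<alpha> \<beta> \<gamma>"
    then show "i \<in> ?q ` {2 - \<beta>..2 + \<gamma>}"
      using 0 assms by (intro image_eqI[of _ _ "if i = 1 then 0 else i - 2"])
        (auto simp: Gamma_labels_def)
  qed (use assms in \<open>auto simp: Gamma_labels_def split: if_splits\<close>)
  moreover have "of_type ip (reduced_div (v ` ?q ` {2 - \<beta>..2 + \<gamma>})) [DynA (2 + \<gamma> + 1 - (2 - \<beta>))]"
    by (rule of_type_label_chain) (use assms in \<open>auto simp: inj_on_def adj_def split: if_splits\<close>)
  ultimately show ?thesis using 0 assms(2) by (simp add: add.commute)
next
  assume 0: "\<beta> = 0"
  \<comment> \<open>The path \<open>S 1\<close>, \<open>C\<close>, \<open>L 1\<close>, ... with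
    \<open>C\<close> at position 1.\<close>
  let ?q = "\<lambda>i :: nat. if i = 0 then 2 else i + 3"
  have "?q ` {1 - \<alpha>..1 + \<gamma>} = Gamma_labels \<alpha> \<beta> \<gamma>"
  proof (intro equalityI subsetI)
    fix i assume "i \<in> Gamma_labels \<alpha> \<beta> \<gamma>"
    then show "i \<in> ?q ` {1 - \<alpha>..1 + \<gamma>}"
      using 0 assms by (intro image_eqI[of _ _ "if i = 2 then 0 else i - 3"])
        (auto simp: Gamma_labels_def)
  qed (use assms in \<open>auto simp: Gamma_labels_def split: if_splits\<close>)
  moreover have "of_type ip (reduced_div (v ` ?q ` {1 - \<alpha>..1 + \<gamma>})) [DynA (1 + \<gamma> + 1 - (1 - \<alpha>))]"
    by (rule of_type_label_chain) (use assms in \<open>auto simp: inj_on_def adj_def split: if_splits\<close>)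
  moreover have "1 + \<gamma> + 1 - (1 - \<alpha>) = 1 + \<alpha> + \<beta> + \<gamma>" using 0 assms(1) by simp
  ultimately show ?thesis by (simp only:)
next
  assume 0: "\<gamma> = 0"
  \<comment> \<open>The path \<open>S 1\<close>, \<open>C\<close>, \<open>M 1\<close>,
    \<open>M 2\<close>.\<close>
  let ?q = "\<lambda>i :: nat. if i = 0 then 2 else if i = 1 then 4 else if i = 2 then 3 else 1"
  have "?q ` {1 - \<alpha>..1 + \<beta>} = Gamma_labels \<alpha> \<beta> \<gamma>"
  proof (intro equalityI subsetI)
    fix i assume "i \<in> Gamma_labels \<alpha> \<beta> \<gamma>"
    then show "i \<in> ?q ` {1 - \<alpha>..1 + \<beta>}"
      using 0 assms by (intro image_eqI[of _ _ "if i = 2 then 0 else if i = 4 then 1 else if i = 3 then 2 else 3"])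
        (auto simp: Gamma_labels_def)
  qed (use assms in \<open>auto simp: Gamma_labels_def split: if_splits\<close>)
  moreover have "of_type ip (reduced_div (v ` ?q ` {1 - \<alpha>..1 + \<beta>})) [DynA (1 + \<beta> + 1 - (1 - \<alpha>))]"
    by (rule of_type_label_chain) (use assms in \<open>auto simp: inj_on_def adj_def split: if_splits\<close>)
  moreover have "1 + \<beta> + 1 - (1 - \<alpha>) = 1 + \<alpha> + \<beta> + \<gamma>" using 0 assms(1) by simp
  ultimately show ?thesis by (simp only:)
qed

text \<open>The long arm of the D-diagram is the L-branch read inwards: vertex 1 goes to
  \<open>L \<gamma>\<close> and the branch vertex \<gamma> + 1 to \<open>C\<close>. The leaves
  \<gamma> + 2 and \<gamma> + 3 go to \<open>S 1\<close> and \<open>M 1\<close>.\<close>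

lemma Gamma_type_D:
  assumes "1 \<le> \<gamma>" "\<gamma> \<le> 5"
  shows "of_type ip (reduced_div (v ` Gamma_labels 1 1 \<gamma>)) [DynD (\<gamma> + 3)]"
proof (rule of_type_labels)
  let ?g = "\<lambda>i. if i = \<gamma> + 2 then 2 else if i = \<gamma> + 3 then 3 else 5 + \<gamma> - i"
  show "bij_betw ?g (verts (dynkin_graph (DynD (\<gamma> + 3)))) (Gamma_labels 1 1 \<gamma>)"
    by (rule bij_betw_byWitness[where f' = "\<lambda>i. if i = 2 then \<gamma> + 2 else if i = 3 then \<gamma> + 3 else 5 + \<gamma> - i"])
      (auto simp: Gamma_labels_def)
  fix i j assume "i \<in> verts (dynkin_graph (DynD (\<gamma> + 3)))" "j \<in> verts (dynkin_graph (DynD (\<gamma> + 3)))" "i < j"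
  then have ij: "1 \<le> i" "i < j" "j \<le> \<gamma> + 3" by auto
  then have "{i, j} \<in> edges (dynkin_graph (DynD (\<gamma> + 3))) \<longleftrightarrow>
      i = \<gamma> + 1 \<and> j = \<gamma> + 3 \<or> j = i + 1 \<and> j \<le> \<gamma> + 2"
    by (auto simp: doubleton_eq_iff)
  moreover consider "j = \<gamma> + 3" "i = \<gamma> + 2" | "j = \<gamma> + 3" "i \<le> \<gamma> + 1" | "j = \<gamma> + 2" "i \<le> \<gamma> + 1"
    | "j \<le> \<gamma> + 1" "i \<le> \<gamma>"
    using ij by linarith
  then have "adj (?g i) (?g j) \<or> adj (?g j) (?g i) \<longleftrightarrow>
      i = \<gamma> + 1 \<and> j = \<gamma> + 3 \<or> j = i + 1 \<and> j \<le> \<gamma> + 2"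
  proof cases
    case 2
    \<comment> \<open>Naming the value by an additive equation removes the truncated subtraction in
      \<open>?g\<close>.\<close>
    obtain x where "?g i = x" "?g j = 3" "x + i = 5 + \<gamma>" "4 \<le> x" using ij 2 by simp
    moreover from this have "adj x 3 \<or> adj 3 x \<longleftrightarrow> x = 4" by (auto simp: adj_def)
    ultimately show ?thesis using 2 by auto
  next
    case 3
    obtain x where "?g i = x" "?g j = 2" "x + i = 5 + \<gamma>" "4 \<le> x" using ij 3 by simp
    moreover from this have "adj x 2 \<or> adj 2 x \<longleftrightarrow> x = 4" by (auto simp: adj_def)
    ultimately show ?thesis using 3 by auto
  next
    case 4
    obtain x y where "?g i = x" "?g j = y" "x + i = 5 + \<gamma>" "y + j = 5 + \<gamma>" "4 \<le> y" using ij 4 by simp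
    moreover from this ij have "adj x y \<or> adj y x \<longleftrightarrow> x = y + 1" by (auto simp: adj_def)
    ultimately show ?thesis using 4 by auto
  qed (simp add: adj_def)
  ultimately show "adj (?g i) (?g j) \<or> adj (?g j) (?g i) \<longleftrightarrow> {i, j} \<in> edges (dynkin_graph (DynD (\<gamma> + 3)))"
    by blast
next
  show "Gamma_labels 1 1 \<gamma> \<subseteq> {1..9}" by (rule Gamma_labels_subset[OF assms(2)])
qed (use assms in simp)

text \<open>Here the M-branch is the long arm: vertices 1 to 5 go to \<open>M 2\<close>,
  \<open>M 1\<close>, \<open>C\<close>, \<open>S 1\<close>, \<open>L 1\<close>.\<close>

lemma Gamma_type_D5: "of_type ip (reduced_div (v ` Gamma_labels 1 2 1)) [DynD 5]"
proof (rule of_type_labels)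
  let ?g = "\<lambda>i :: nat. if i = 2 then 3 else if i = 3 then 4 else if i = 4 then 2 else i"
  show "bij_betw ?g (verts (dynkin_graph (DynD 5))) (Gamma_labels 1 2 1)"
    by (rule bij_betw_byWitness[where f' = "\<lambda>i. if i = 3 then 2 else if i = 4 then 3 else if i = 2 then 4 else i"])
      (auto simp: Gamma_labels_def)
  fix i j assume "i \<in> verts (dynkin_graph (DynD 5))" "j \<in> verts (dynkin_graph (DynD 5))" "i < j"
  then show "adj (?g i) (?g j) \<or> adj (?g j) (?g i) \<longleftrightarrow> {i, j} \<in> edges (dynkin_graph (DynD 5))"
    by (auto simp: adj_def doubleton_eq_iff)
qed (use Gamma_labels_subset in auto)

text \<open>With both M-curves and \<open>S 1\<close> present the labels are exactly
  \<open>{1..4 + \<gamma>}\<close>, so by the choice of numbering the identity is an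
  isomorphism.\<close>

lemma Gamma_type_E:
  assumes "valid_dynkin t" "dynkin_graph t = E_graph (4 + \<gamma>)" "\<gamma> \<le> 5"
  shows "of_type ip (reduced_div (v ` Gamma_labels 1 2 \<gamma>)) [t]"
proof (rule of_type_labels)
  show "bij_betw id (verts (dynkin_graph t)) (Gamma_labels 1 2 \<gamma>)"
    by (auto simp: assms E_graph_def Gamma_labels_def bij_betw_def)
  fix i j assume "i \<in> verts (dynkin_graph t)" "j \<in> verts (dynkin_graph t)" "i < j"
  then show "adj (id i) (id j) \<or> adj (id j) (id i) \<longleftrightarrow> {i, j} \<in> edges (dynkin_graph t)"
    by (auto simp: assms E_graph_def adj_def doubleton_eq_iff)
qed (use assms Gamma_labels_subset in auto)

lemma Gamma_type:
  assumes "\<alpha> \<le> 1" "\<beta> \<le> 2" "\<gamma> \<le> 5" "(\<alpha>, \<beta>, \<gamma>) \<noteq> (1, 2, 5)"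
    and "\<Gamma> = reduced_div (v ` Gamma_labels \<alpha> \<beta> \<gamma>)"
  shows "(\<alpha> = 0 \<or> \<beta> = 0 \<or> \<gamma> = 0) \<and> of_type ip \<Gamma> [DynA (1 + \<alpha> + \<beta> + \<gamma>)]
            \<or>
            \<alpha> \<noteq> 0 \<and> \<beta> \<noteq> 0 \<and> \<gamma> \<noteq> 0 \<and> \<alpha> = 1 \<and> (\<beta>, \<gamma>) \<noteq> (2, 5) \<and>
            (\<beta> = 1 \<longrightarrow> of_type ip \<Gamma> [DynD (\<gamma> + 3)]) \<and>
            ((\<beta>, \<gamma>) = (2, 1) \<longrightarrow> of_type ip \<Gamma> [DynD 5]) \<and>
            ((\<beta>, \<gamma>) = (2, 2) \<longrightarrow> of_type ip \<Gamma> [DynE6]) \<and>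
            ((\<beta>, \<gamma>) = (2, 3) \<longrightarrow> of_type ip \<Gamma> [DynE7]) \<and>
            ((\<beta>, \<gamma>) = (2, 4) \<longrightarrow> of_type ip \<Gamma> [DynE8])"
proof (cases "\<alpha> = 0 \<or> \<beta> = 0 \<or> \<gamma> = 0")
  case True
  with Gamma_type_A assms show ?thesis by blast
next
  case False
  moreover from this have "\<alpha> = 1" "1 \<le> \<gamma>" using assms(1) by auto
  moreover have "of_type ip (reduced_div (v ` Gamma_labels 1 2 2)) [DynE6]"
    "of_type ip (reduced_div (v ` Gamma_labels 1 2 3)) [DynE7]"
    "of_type ip (reduced_div (v ` Gamma_labels 1 2 4)) [DynE8]"
    by (rule Gamma_type_E; simp)+
  ultimately show ?thesis using assms Gamma_type_D Gamma_type_D5 by auto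
qed

lemma Gamma_has_type:
  assumes "\<alpha> \<le> 1" "\<beta> \<le> 2" "\<gamma> \<le> 5" "(\<alpha>, \<beta>, \<gamma>) \<noteq> (1, 2, 5)"
  obtains t where "of_type ip (reduced_div (v ` Gamma_labels \<alpha> \<beta> \<gamma>)) [t]"
proof -
  have "\<beta> = 0 \<or> \<beta> = 1 \<or> \<beta> = 2 \<and> (\<gamma> = 0 \<or> \<gamma> = 1 \<or> \<gamma> = 2 \<or> \<gamma> = 3 \<or> \<gamma> = 4 \<or> \<gamma> = 5)"
    using assms(2,3) by auto
  then show thesis
    using Gamma_type[OF assms refl] that by auto
qed

section \<open>Reading \<alpha>, \<beta>, \<gamma> and the tails off the label set\<close>

text \<open>No bound on \<open>\<gamma>\<close> is needed: for \<open>J \<subseteq> {1..9}\<close> the label \<open>10\<close> of the nonexistent \<open>L\<^sub>6\<close> is missing.\<close>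

definition max_Gamma :: "nat set \<Rightarrow> nat \<Rightarrow> nat \<Rightarrow> nat \<Rightarrow> bool" where
  "max_Gamma J \<alpha> \<beta> \<gamma> \<longleftrightarrow>
     \<alpha> = of_bool (2 \<in> J) \<and> \<beta> = (if 3 \<in> J then 1 + of_bool (1 \<in> J) else 0) \<and>
     {4..4 + \<gamma>} \<subseteq> J \<and> 5 + \<gamma> \<notin> J"

lemma max_Gamma_bounds:
  assumes "J \<subseteq> {1..9}" "max_Gamma J \<alpha> \<beta> \<gamma>"
  shows "\<alpha> \<le> 1" "\<beta> \<le> 2" "\<gamma> \<le> 5"
proof -
  have "4 + \<gamma> \<in> J" using assms(2) by (auto simp: max_Gamma_def)
  with assms(1) show "\<gamma> \<le> 5" by auto
qed (use assms(2) in \<open>auto simp: max_Gamma_def\<close>)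

lemma max_Gamma_unique:
  assumes "max_Gamma J \<alpha> \<beta> \<gamma>" "max_Gamma J \<alpha>' \<beta>' \<gamma>'"
  shows "\<alpha> = \<alpha>' \<and> \<beta> = \<beta>' \<and> \<gamma> = \<gamma>'"
proof -
  have "\<not> k < l" if "5 + k \<notin> J" "{4..4 + l} \<subseteq> J" for k l
  proof
    assume "k < l"
    then have "5 + k \<in> {4..4 + l}" by simp
    with that show False by blast
  qed
  then have "\<gamma> = \<gamma>'" using assms unfolding max_Gamma_def by (metis linorder_neqE_nat)
  with assms show ?thesis by (simp add: max_Gamma_def)
qed

lemma max_Gamma_exists:
  assumes "J \<subseteq> {1..9}" "4 \<in> J"
  obtains \<alpha> \<beta> \<gamma> where "max_Gamma J \<alpha> \<beta> \<gamma>"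
proof -
  define \<gamma> where "\<gamma> = (LEAST k. 5 + k \<notin> J)"
  have "5 + 5 \<notin> J" using assms(1) by auto
  then have "5 + \<gamma> \<notin> J" unfolding \<gamma>_def by (rule LeastI)
  moreover have "{4..4 + \<gamma>} \<subseteq> J"
  proof
    fix i assume i: "i \<in> {4..4 + \<gamma>}"
    show "i \<in> J"
    proof (cases "i = 4")
      case False
      with i have "i - 5 < \<gamma>" "i = 5 + (i - 5)" by auto
      then show ?thesis unfolding \<gamma>_def using not_less_Least by metis
    qed (use assms in simp)
  qed
  ultimately show thesis using that unfolding max_Gamma_def by blast
qed

text \<open>On labels, the component of \<open>C\<close> is the least subset of \<open>J\<close>
  that contains 4 and is closed under adjacency in \<open>J\<close>: \<open>start\<close> and
  \<open>step\<close> give closure, \<open>closed\<close> gives minimality. Closure forces the next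
  label on each branch to be missing; conversely, a \<Gamma> that stops only at missing labels is
  closed, and its labels are reached outwards from 4.\<close>

lemma component_eq_iff:
  assumes J: "J \<subseteq> {1..9}" "4 \<in> J" and "\<alpha> \<le> 1" "\<beta> \<le> 2" "\<gamma> \<le> 5"
  shows "component_through ip (reduced_div (v ` J)) C = Gamma_div C S M L \<alpha> \<beta> \<gamma> \<longleftrightarrow>
    max_Gamma J \<alpha> \<beta> \<gamma>"
proof -
  let ?G = "dual_graph ip (reduced_div (v ` J))" and ?\<Gamma> = "Gamma_labels \<alpha> \<beta> \<gamma>"
  define comp where "comp = {i \<in> J. v i \<in> connected_component ?G C}"
  have G: "?G = \<lparr>verts = v ` J,
      edges = {{X, Y} | X Y. X \<in> v ` J \<and> Y \<in> v ` J \<and> X \<noteq> Y \<and> ip X Y \<noteq> 0}\<rparr>"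
    by (rule dual_graph_reduced_div[OF finite_index[OF J(1)]])
  have verts: "connected_component ?G C \<subseteq> v ` J"
    by (auto simp: connected_component_def G)
  then have comp_image: "connected_component ?G C = v ` comp"
    unfolding comp_def by blast
  have comp_J: "comp \<subseteq> J" unfolding comp_def by blast
  have edge: "{v i, v j} \<in> edges ?G \<longleftrightarrow> adj i j \<or> adj j i" if "i \<in> J" "j \<in> J" for i j
  proof (cases "i = j")
    case True
    then show ?thesis by (auto simp: G adj_def)
  next
    case False
    have ij: "i \<in> {1..9}" "j \<in> {1..9}" using that J by blast+
    then have "v i \<noteq> v j" using False inj_v by (auto dest: inj_onD)
    moreover have "v i \<in> v ` J" "v j \<in> v ` J" using that by blast+
    ultimately have "{v i, v j} \<in> edges ?G \<longleftrightarrow> ip (v i) (v j) \<noteq> 0"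
      using ip_sym[OF ij] by (simp add: G doubleton_eq_iff) metis
    then show ?thesis using ip_v[OF ij False] by simp
  qed
  have start: "4 \<in> comp"
    using J(2) imageI[OF J(2), of v] by (simp add: comp_def connected_component_def v_4 G)
  have step: "j \<in> comp" if "i \<in> comp" "j \<in> J" "adj i j \<or> adj j i" for i j
  proof -
    have "i \<in> J" using that comp_J by blast
    then have "(v i, v j) \<in> {(X, Y). {X, Y} \<in> edges ?G}"
      using edge[of i j] that(2,3) by simp
    moreover have "(C, v i) \<in> {(X, Y). {X, Y} \<in> edges ?G}\<^sup>*"
      using that(1) by (simp add: comp_def connected_component_def)
    ultimately have "(C, v j) \<in> {(X, Y). {X, Y} \<in> edges ?G}\<^sup>*"
      by (rule rtrancl_into_rtrancl[rotated])
    with that(2) show ?thesis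
      by (simp add: comp_def connected_component_def G)
  qed
  have closed: "comp \<subseteq> A" if "4 \<in> A" "A \<subseteq> J"
    and A: "\<And>i j. \<lbrakk>i \<in> A; j \<in> J; adj i j \<or> adj j i\<rbrakk> \<Longrightarrow> j \<in> A" for A
  proof
    have reach: "Y \<in> v ` A" if "(C, Y) \<in> {(X, Y). {X, Y} \<in> edges ?G}\<^sup>*" for Y
      using that
    proof induction
      case base
      show ?case using \<open>4 \<in> A\<close> v_4 by force
    next
      case (step Y Z)
      then obtain i where i: "i \<in> A" "Y = v i" by blast
      from step have "{Y, Z} \<in> edges ?G" by simp
      then have "Z \<in> v ` J" by (auto simp: G doubleton_eq_iff)
      then obtain j where j: "j \<in> J" "Z = v j" by blast
      have "i \<in> J" using i \<open>A \<subseteq> J\<close> by blast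
      then have "adj i j \<or> adj j i"
        using edge[of i j] i j \<open>{Y, Z} \<in> edges ?G\<close> by simp
      with A i j show ?case by blast
    qed
    fix i assume "i \<in> comp"
    then have "v i \<in> v ` A" "i \<in> J" using reach by (auto simp: comp_def connected_component_def)
    then show "i \<in> A" using v_mem_image[of i A] \<open>A \<subseteq> J\<close> J by blast
  qed
  have "component_through ip (reduced_div (v ` J)) C = reduced_div (v ` comp)"
    unfolding component_through_def comp_image by (simp add: reduced_div_def)
  also have "\<dots> = Gamma_div C S M L \<alpha> \<beta> \<gamma> \<longleftrightarrow> comp = ?\<Gamma>"
  proof -
    have "comp \<subseteq> {1..9}" "?\<Gamma> \<subseteq> {1..9}"
      using comp_J J Gamma_labels_subset assms(5) by blast+
    then show ?thesis
      unfolding Gamma_div_eq[OF assms(3-5)]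
      by (simp add: reduced_div_inject finite_index v_image_inject)
  qed
  also have "comp = ?\<Gamma> \<longleftrightarrow> max_Gamma J \<alpha> \<beta> \<gamma>"
  proof
    assume eq: "comp = ?\<Gamma>"
    have 2: "2 \<in> ?\<Gamma>" if "2 \<in> J" using step[of 4 2] start that unfolding eq by (simp add: adj_def)
    have 3: "3 \<in> ?\<Gamma>" if "3 \<in> J" using step[of 4 3] start that unfolding eq by (simp add: adj_def)
    have 1: "1 \<in> ?\<Gamma>" if "3 \<in> J" "1 \<in> J" using step[of 3 1] 3 that unfolding eq by (simp add: adj_def)
    \<comment> \<open>Label 5 + \<gamma> is adjacent to 4 + \<gamma>, the last label of \<Gamma> on
      the L-branch (or \<open>C\<close> if \<gamma> = 0), so its presence would enlarge the
      component.\<close>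
    have next_L: "5 + \<gamma> \<notin> J"
    proof
      assume "5 + \<gamma> \<in> J"
      then have "5 + \<gamma> \<in> ?\<Gamma>" using step[of "4 + \<gamma>" "5 + \<gamma>"] unfolding eq
        by (simp add: adj_def Gamma_labels_def)
      then show False by (simp add: Gamma_labels_def)
    qed
    have sub: "?\<Gamma> \<subseteq> J" using comp_J eq by simp
    have "2 \<in> J \<longleftrightarrow> 1 \<le> \<alpha>" "3 \<in> J \<longleftrightarrow> 1 \<le> \<beta>" "3 \<in> J \<Longrightarrow> 1 \<in> J \<longleftrightarrow> 2 \<le> \<beta>"
      using sub 1 2 3 by (auto simp: Gamma_labels_def)
    moreover have "{4..4 + \<gamma>} \<subseteq> J" using sub by (auto simp: Gamma_labels_def)
    ultimately show "max_Gamma J \<alpha> \<beta> \<gamma>"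
      using next_L assms(3,4) by (auto simp: max_Gamma_def)
  next
    assume max: "max_Gamma J \<alpha> \<beta> \<gamma>"
    have sub: "?\<Gamma> \<subseteq> J"
      using max by (auto simp: max_Gamma_def Gamma_labels_def split: if_splits)
    show "comp = ?\<Gamma>"
    proof
      show "comp \<subseteq> ?\<Gamma>"
      proof (rule closed[OF _ sub])
        fix i j assume ij: "i \<in> ?\<Gamma>" "j \<in> J" "adj i j \<or> adj j i"
        have J_mem: "2 \<in> J \<longleftrightarrow> 1 \<le> \<alpha>" "3 \<in> J \<longleftrightarrow> 1 \<le> \<beta>" "3 \<in> J \<Longrightarrow> 1 \<in> J \<longleftrightarrow> 2 \<le> \<beta>" "j \<noteq> 5 + \<gamma>"
          using max ij(2) by (auto simp: max_Gamma_def)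
        \<comment> \<open>Only moves onto 1, 2, 3 or 5 + \<gamma> could leave \<Gamma>. The first
          three stay inside because \<alpha> and \<beta> record membership in \<open>J\<close>; the
          last is blocked by 5 + \<gamma> missing from \<open>J\<close>.\<close>
        from ij(3) consider "i = 1" "j = 3" | "i = 3" "j = 1" | "j = 2" | "i = 2" "j = 4" | "j = 3"
          | "3 \<le> i" "j = i + 1" | "4 \<le> j" "i = j + 1"
          unfolding adj_def by force
        then show "j \<in> ?\<Gamma>"
          using J_mem ij(1,2) by cases (auto simp: Gamma_labels_def)
      qed (simp add: Gamma_labels_def)
      have "4 + k \<in> comp" if "k \<le> \<gamma>" for k
        using that
      proof (induction k)
        case (Suc k)
        then have "4 + Suc k \<in> ?\<Gamma>" by (simp add: Gamma_labels_def)
        with sub have "4 + Suc k \<in> J" by blast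
        moreover have "4 + k \<in> comp" using Suc by simp
        ultimately show ?case using step[of "4 + k" "4 + Suc k"] by (simp add: adj_def)
      qed (simp add: start)
      then have chain: "{4..4 + \<gamma>} \<subseteq> comp"
        by (metis atLeastAtMost_iff le_iff_add nat_add_left_cancel_le subsetI)
      have "2 \<in> comp" if "1 \<le> \<alpha>"
        using step[OF start, of 2] sub that by (auto simp: adj_def Gamma_labels_def)
      moreover have 3: "3 \<in> comp" if "1 \<le> \<beta>"
        using step[OF start, of 3] sub that by (auto simp: adj_def Gamma_labels_def)
      moreover have "1 \<in> comp" if "2 \<le> \<beta>"
        using step[OF 3, of 1] sub that by (auto simp: adj_def Gamma_labels_def)
      ultimately show "?\<Gamma> \<subseteq> comp"
        using chain by (auto simp: Gamma_labels_def)
    qed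
  qed
  finally show ?thesis .
qed

text \<open>Labels 2 and 4 belong to \<Gamma> whenever they are in \<open>J\<close>, so the rest of
  \<open>J\<close> lies on \<open>{1, 3}\<close> and \<open>{5..9}\<close>. These sets are disjoint,
  so the sum of the two tails determines each of them.\<close>

lemma ader_decomposition_iff:
  assumes J: "J \<subseteq> {1..9}" "4 \<in> J"
  shows "ader_decomposition ip C S M L (reduced_div (v ` J)) \<alpha> \<beta> \<gamma> RM RL \<longleftrightarrow>
    max_Gamma J \<alpha> \<beta> \<gamma> \<and>
    RM = reduced_div (v ` (J \<inter> {1, 3} - Gamma_labels \<alpha> \<beta> \<gamma>)) \<and>
    RL = reduced_div (v ` (J \<inter> {5..9} - Gamma_labels \<alpha> \<beta> \<gamma>))"
    (is "?D \<longleftrightarrow> _ \<and> RM = ?RM \<and> RL = ?RL")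
proof -
  let ?\<Gamma> = "Gamma_labels \<alpha> \<beta> \<gamma>"
  have range: "\<alpha> \<in> {0, 1} \<and> \<beta> \<in> {0, 1, 2} \<and> \<gamma> \<in> {0, 1, 2, 3, 4, 5} \<longleftrightarrow> \<alpha> \<le> 1 \<and> \<beta> \<le> 2 \<and> \<gamma> \<le> 5"
    by auto
  have M: "M ` {1..2} = v ` {1, 3}"
    by (auto simp: v_def numeral_2_eq_2 atLeastAtMostSuc_conv)
  have L: "L ` {1..5} = v ` {5..9}"
  proof -
    have "L ` {1..5} = (\<lambda>i. v (i + 4)) ` {1..5}" by (rule image_cong) (auto simp: v_def)
    also have "\<dots> = v ` (\<lambda>i. i + 4) ` {1..5}" by (simp only: image_image)
    finally show ?thesis by simp
  qed
  have sub: "J \<inter> {1, 3} - ?\<Gamma> \<subseteq> {1..9}" "J \<inter> {5..9} - ?\<Gamma> \<subseteq> {1..9}" using J by auto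
  have Supp: "Supp ?RM \<subseteq> v ` {1, 3}" "Supp ?RL \<subseteq> v ` {5..9}"
    using sub by (auto simp: Supp_reduced_div finite_index)
  have sum: "reduced_div (v ` J) = Gamma_div C S M L \<alpha> \<beta> \<gamma> + ?RM + ?RL" if max: "max_Gamma J \<alpha> \<beta> \<gamma>"
  proof -
    have \<Gamma>: "?\<Gamma> \<subseteq> J" using max by (auto simp: max_Gamma_def Gamma_labels_def split: if_splits)
    have "J \<subseteq> ?\<Gamma> \<union> {1, 3} \<union> {5..9}"
    proof
      fix i assume i: "i \<in> J"
      then have "i \<in> {1..9}" using J by blast
      then have "i \<in> {1, 3} \<union> {5..9} \<or> i = 2 \<or> i = 4" by auto
      then show "i \<in> ?\<Gamma> \<union> {1, 3} \<union> {5..9}" using i max by (auto simp: max_Gamma_def Gamma_labels_def)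
    qed
    with \<Gamma> have J_eq: "J = ?\<Gamma> \<union> (J \<inter> {1, 3} - ?\<Gamma>) \<union> (J \<inter> {5..9} - ?\<Gamma>)" by blast
    have union: "reduced_div (v ` (A \<union> B)) = reduced_div (v ` A) + reduced_div (v ` B)"
      if "A \<subseteq> {1..9}" "B \<subseteq> {1..9}" "A \<inter> B = {}" for A B
      using that inj_on_image_Int[OF inj_v that(1,2)]
      by (simp add: image_Un reduced_div_Un finite_index)
    have "?\<Gamma> \<subseteq> {1..9}" using \<Gamma> J by blast
    then have "reduced_div (v ` (?\<Gamma> \<union> (J \<inter> {1, 3} - ?\<Gamma>) \<union> (J \<inter> {5..9} - ?\<Gamma>))) =
        reduced_div (v ` ?\<Gamma>) + ?RM + ?RL"
      using sub by (subst union, blast, blast, force, subst union) auto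
    then show ?thesis
      using J_eq Gamma_div_eq max_Gamma_bounds[OF J(1) max] by simp
  qed
  have "v ` {1, 3} \<inter> v ` {5..9} = v ` ({1, 3} \<inter> {5..9})"
    by (rule inj_on_image_Int[OF inj_v, symmetric]) auto
  then have disj: "v ` {1, 3} \<inter> v ` {5..9} = {}" by simp
  show ?thesis
  proof
    assume D: ?D
    then have "max_Gamma J \<alpha> \<beta> \<gamma>"
      using component_eq_iff[OF J] range unfolding ader_decomposition_def by blast
    moreover from this D have "RM + RL = ?RM + ?RL"
      using sum by (simp add: ader_decomposition_def add.assoc)
    then have "RM = ?RM \<and> RL = ?RL"
      by (rule add_eq_add_disjoint_Supp[OF disj])
        (use D Supp in \<open>simp_all only: ader_decomposition_def M L\<close>)
    ultimately show "max_Gamma J \<alpha> \<beta> \<gamma> \<and> RM = ?RM \<and> RL = ?RL" by blast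
  next
    assume "max_Gamma J \<alpha> \<beta> \<gamma> \<and> RM = ?RM \<and> RL = ?RL"
    then show ?D
      unfolding ader_decomposition_def M L
      using component_eq_iff[OF J] range sum Supp max_Gamma_bounds[OF J(1)] by blast
  qed
qed

lemma ex1_ader_decomposition:
  assumes "J \<subseteq> {1..9}" "4 \<in> J"
  shows "\<exists>!(\<alpha>, \<beta>, \<gamma>, RM, RL). ader_decomposition ip C S M L (reduced_div (v ` J)) \<alpha> \<beta> \<gamma> RM RL"
proof -
  obtain \<alpha> \<beta> \<gamma> where "max_Gamma J \<alpha> \<beta> \<gamma>" by (rule max_Gamma_exists[OF assms])
  then show ?thesis
    unfolding ader_decomposition_iff[OF assms]
    by (intro ex1I[of _ "(\<alpha>, \<beta>, \<gamma>, _, _)"]) (auto dest: max_Gamma_unique)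
qed

subsection \<open>The whole fiber\<close>

lemma whole_fiber_not_of_type: "\<not> of_type ip (reduced_div (v ` {1..9})) ts"
proof
  assume "of_type ip (reduced_div (v ` {1..9})) ts"
  moreover define T where "T = dynkin_sum_graph ts"
  ultimately obtain f where f: "bij_betw f (v ` {1..9}) (verts T)"
    "edges T = (\<lambda>e. f ` e) ` edges (dual_graph ip (reduced_div (v ` {1..9})))"
    and valid: "\<forall>t\<in>set ts. valid_dynkin t"
    unfolding of_type_def graph_of_type_def graph_iso_def by (auto simp: dual_graph_reduced_div)
  define h where "h = f \<circ> v"
  have h: "bij_betw h {1..9} (verts T)"
    unfolding h_def using inj_v f(1) by (blast intro: bij_betw_trans bij_betw_imageI)
  have edge: "\<exists>k<length ts. \<exists>a b. h i = (k, a) \<and> h j = (k, b) \<and> {a, b} \<in> edges (dynkin_graph (ts ! k))"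
    if "i \<in> {1..9}" "j \<in> {1..9}" "adj i j \<or> adj j i" for i j
  proof -
    have "i \<noteq> j" using that by (auto simp: adj_def)
    then have "v i \<noteq> v j" "ip (v i) (v j) \<noteq> 0"
      using that inj_v ip_v[of i j] by (auto dest: inj_onD)
    moreover have "v i \<in> v ` {1..9}" "v j \<in> v ` {1..9}" using that by blast+
    ultimately have "{v i, v j} \<in> edges (dual_graph ip (reduced_div (v ` {1..9})))"
      unfolding dual_graph_reduced_div[OF finite_index[OF order_refl]]
      by (simp only: graph.select_convs) blast
    then have "f ` {v i, v j} \<in> edges T"
      unfolding f(2) by (rule imageI)
    then have "{h i, h j} \<in> edges T" by (simp add: h_def)
    then obtain k e where k: "k < length ts" "e \<in> edges (dynkin_graph (ts ! k))" "{h i, h j} = Pair k ` e"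
      by (auto simp: T_def dynkin_sum_graph_def)
    then have "h i \<in> Pair k ` e" "h j \<in> Pair k ` e" by blast+
    then obtain a b where ab: "h i = (k, a)" "h j = (k, b)" by blast
    have "e = snd ` {h i, h j}" unfolding k(3) by (simp add: image_image)
    with ab have "e = {a, b}" by simp
    with ab k show ?thesis by blast
  qed
  define k where "k = fst (h 4)"
  define g where "g = snd \<circ> h"
  define t where "t = ts ! k"
  \<comment> \<open>The summand index is constant along edges and the fiber is connected, so one
    summand \<open>t\<close> receives all nine labels.\<close>
  have same: "fst (h i) = fst (h j)" if "i \<in> {1..9}" "j \<in> {1..9}" "adj i j \<or> adj j i" for i j
    using edge[OF that] by auto
  have "fst (h 2) = k" "fst (h 3) = k" "fst (h 1) = k" "fst (h 5) = k" "fst (h 6) = k"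
    "fst (h 7) = k" "fst (h 8) = k" "fst (h 9) = k"
    using same[of 4 2] same[of 4 3] same[of 3 1] same[of 4 5] same[of 5 6] same[of 6 7]
      same[of 7 8] same[of 8 9] unfolding k_def by (simp_all add: adj_def)
  then have fst_h: "fst (h i) = k" if "i \<in> {1..9}" for i
    using that k_def unfolding labels by auto
  then have h_eq: "h i = (k, g i)" if "i \<in> {1..9}" for i
    using that unfolding g_def by (metis comp_apply prod.collapse)
  have k: "k < length ts"
    using edge[of 4 5] h_eq[of 4] by (auto simp: adj_def)
  then have t: "valid_dynkin t" using valid by (simp add: t_def)
  have g: "bij_betw g {1..9} (verts (dynkin_graph t))"
  proof (rule bij_betw_imageI)
    show "inj_on g {1..9}"
      using h h_eq by (auto simp: bij_betw_def inj_on_def)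
    \<comment> \<open>Surjectivity of \<open>h\<close> onto the whole sum gives surjectivity of
      \<open>g\<close> onto the vertices of summand \<open>k\<close>.\<close>
    have "(k, x) \<in> h ` {1..9} \<longleftrightarrow> x \<in> verts (dynkin_graph t)" for x
      using h k by (auto simp: bij_betw_def T_def dynkin_sum_graph_def t_def)
    moreover have "(k, x) \<in> h ` {1..9} \<longleftrightarrow> x \<in> g ` {1..9}" for x
      using h_eq by (auto simp: image_iff)
    ultimately show "g ` {1..9} = verts (dynkin_graph t)" by blast
  qed
  have gE: "{g i, g j} \<in> edges (dynkin_graph t)" if "i \<in> {1..9}" "j \<in> {1..9}" "adj i j \<or> adj j i" for i j
    using edge[OF that] h_eq that by (auto simp: t_def)
  have distinct: "g i \<noteq> g j" if "i \<in> {1..9}" "j \<in> {1..9}" "i \<noteq> j" for i j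
    using g that by (auto simp: bij_betw_def dest: inj_onD)
  have nb: "{g 4, g 2} \<in> edges (dynkin_graph t)" "{g 4, g 3} \<in> edges (dynkin_graph t)"
    "{g 4, g 5} \<in> edges (dynkin_graph t)" "{g 3, g 1} \<in> edges (dynkin_graph t)"
    "{g 5, g 6} \<in> edges (dynkin_graph t)"
    by (rule gE; simp add: adj_def)+
  have ne: "g 2 \<noteq> g 3" "g 2 \<noteq> g 5" "g 3 \<noteq> g 5" "g 4 \<noteq> g 1" "g 4 \<noteq> g 6"
    by (rule distinct; simp)+
  have "card (verts (dynkin_graph t)) = 9"
    using bij_betw_same_card[OF g] by simp
  then consider "t = DynA 9" | "t = DynD 9"
    by (cases t) (auto simp: E_graph_def)
  then show False
  proof cases
    case 1
    \<comment> \<open>A vertex of an A-diagram has at most two neighbours, whereas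
      \<open>g 4\<close> has the three distinct neighbours \<open>g 2\<close>, \<open>g 3\<close>,
      \<open>g 5\<close>.\<close>
    have "b = a + 1 \<or> a = b + 1" if "{a, b} \<in> edges (dynkin_graph t)" for a b
      using that 1 by (auto simp: doubleton_eq_iff)
    from this[OF nb(1)] this[OF nb(2)] this[OF nb(3)] ne show False by auto
  next
    case 2
    text \<open>The branch vertex \<open>7\<close> of \<open>D\<^sub>9\<close> has two leaves as neighbours, but \<open>C\<close> is adjacent to only one
      leaf.\<close>
    have D: "a = 7 \<and> b = 9 \<or> a = 9 \<and> b = 7 \<or> b = a + 1 \<and> a \<le> 7 \<or> a = b + 1 \<and> b \<le> 7"
      if "{a, b} \<in> edges (dynkin_graph t)" for a b
      using that 2 by (auto simp: doubleton_eq_iff)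
    have g4: "g 4 = 7"
      using D[OF nb(1)] D[OF nb(2)] D[OF nb(3)] ne by auto
    have leaf: "b = 7" if "{a, b} \<in> edges (dynkin_graph t)" "a = 8 \<or> a = 9" for a b
      using D[OF that(1)] that(2) by auto
    \<comment> \<open>Both \<open>g 3\<close> and \<open>g 5\<close> have a second neighbour,
      \<open>g 1\<close> and \<open>g 6\<close>, besides \<open>g 4\<close>. So neither is a leaf,
      and both would have to be the remaining neighbour 6 of the branch vertex.\<close>
    have "\<not> (g 3 = 8 \<or> g 3 = 9)" "\<not> (g 5 = 8 \<or> g 5 = 9)"
      using leaf[OF nb(4)] leaf[OF nb(5)] g4 ne by auto
    moreover have "g 3 = 6 \<or> g 3 = 8 \<or> g 3 = 9" "g 5 = 6 \<or> g 5 = 8 \<or> g 5 = 9"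
      using D[OF nb(2)] D[OF nb(3)] g4 by auto
    ultimately show False using ne by auto
  qed
qed

subsection \<open>The tails\<close>

lemma L_eq_v: "1 \<le> i \<Longrightarrow> L i = v (i + 4)"
  by (simp add: v_def)

lemma inj_on_L: "1 \<le> m \<Longrightarrow> n \<le> 5 \<Longrightarrow> inj_on L {m..n}"
  by (rule inj_onI) (use inj_onD[OF inj_v] in \<open>fastforce simp: L_eq_v\<close>)

lemma ip_L_sym: "\<lbrakk>i \<in> {1..5}; j \<in> {1..5}\<rbrakk> \<Longrightarrow> ip (L i) (L j) = ip (L j) (L i)"
  using ip_sym by (simp add: L_eq_v)

lemma ip_L: "\<lbrakk>i \<in> {1..5}; j \<in> {1..5}; i < j\<rbrakk> \<Longrightarrow> ip (L i) (L j) \<noteq> 0 \<longleftrightarrow> j = i + 1"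
  using ip_v[of "i + 4" "j + 4"] by (auto simp: L_eq_v adj_def)

text \<open>With exclusive upper end 6, the estimate for intervals reads: lengths plus number of
  intervals at most 6 + 1 - (\<gamma> + 2) = 5 - \<gamma>. This is the required bound after
  subtracting 1.\<close>

lemma L_tail:
  assumes "I \<subseteq> {\<gamma> + 2..5}" "\<gamma> \<le> 3"
  shows "union_of_subchains L (\<gamma> + 2) 5 (reduced_div (L ` I))"
    and "bounded_A_type ip (reduced_div (L ` I)) \<gamma>"
proof -
  have "\<gamma> + 2 \<le> 6" "I \<subseteq> {\<gamma> + 2..<6}" using assms by auto
  from decompose_into_intervals[OF this] obtain cs where
    range: "\<forall>(a, b)\<in>set cs. \<gamma> + 2 \<le> a \<and> a \<le> b \<and> b < 6" and
    sorted: "sorted_wrt (\<lambda>(a, b) (c, d). d + 1 < a) cs" and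
    I: "I = (\<Union>(a, b)\<in>set cs. {a..b})" and
    bound: "(\<Sum>(a, b)\<leftarrow>cs. b + 1 - a) + length cs \<le> 6 + 1 - (\<gamma> + 2)"
    by blast
  have range': "\<forall>(a, b)\<in>set cs. \<gamma> + 2 \<le> a \<and> a \<le> b \<and> b \<le> 5" using range by fastforce
  show "union_of_subchains L (\<gamma> + 2) 5 (reduced_div (L ` I))"
    unfolding I by (rule union_of_subchainsI[OF sorted range' inj_on_L]) auto
  have "of_type ip (reduced_div (L ` I)) (map DynA (map (\<lambda>(a, b). b + 1 - a) cs))"
    unfolding I by (rule of_type_intervals[OF sorted range' inj_on_L]) (use ip_L_sym ip_L in auto)
  moreover have "1 \<le> l" if "l \<in> set (map (\<lambda>(a, b). b + 1 - a) cs)" for l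
    using that range' by fastforce
  moreover have "int (sum_list (map (\<lambda>(a, b). b + 1 - a) cs)) +
      int (length (map (\<lambda>(a, b). b + 1 - a) cs)) - 1 \<le> 4 - int \<gamma>"
    using bound assms(2) by simp
  ultimately show "bounded_A_type ip (reduced_div (L ` I)) \<gamma>"
    unfolding bounded_A_type_def by blast
qed

lemma M2_type: "of_type ip (prime_div (M 2)) [DynA 1]"
proof -
  have "of_type ip (reduced_div (v ` (\<lambda>_. 1) ` {1..1 :: nat})) [DynA (1 + 1 - 1)]"
    by (rule of_type_label_chain) auto
  then show ?thesis by (simp add: reduced_div_def v_def)
qed

section \<open>Properties of a given decomposition, and the converse\<close>

lemma decomposition_properties:
  assumes J: "J \<subseteq> {1..9}" "4 \<in> J" and ader: "ADER ip F (reduced_div (v ` J))"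
    and D: "ader_decomposition ip C S M L (reduced_div (v ` J)) \<alpha> \<beta> \<gamma> RM RL"
  shows "\<alpha> \<le> 1" "\<beta> \<le> 2" "\<gamma> \<le> 5" "(\<alpha>, \<beta>, \<gamma>) \<noteq> (1, 2, 5)"
    and "component_through ip (reduced_div (v ` J)) C = reduced_div (v ` Gamma_labels \<alpha> \<beta> \<gamma>)"
    and "\<beta> \<ge> 1 \<longrightarrow> RM = 0" "RM = 0 \<or> RM = prime_div (M 2)"
    and "\<gamma> \<le> 3 \<longrightarrow> union_of_subchains L (\<gamma> + 2) 5 RL" "\<gamma> \<ge> 4 \<longrightarrow> RL = 0"
    and "RL \<noteq> 0 \<longrightarrow> bounded_A_type ip RL \<gamma>"
proof -
  let ?\<Gamma> = "Gamma_labels \<alpha> \<beta> \<gamma>"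
  from D have max: "max_Gamma J \<alpha> \<beta> \<gamma>"
    and RM: "RM = reduced_div (v ` (J \<inter> {1, 3} - ?\<Gamma>))"
    and RL: "RL = reduced_div (v ` (J \<inter> {5..9} - ?\<Gamma>))"
    unfolding ader_decomposition_iff[OF J] by blast+
  show bounds: "\<alpha> \<le> 1" "\<beta> \<le> 2" "\<gamma> \<le> 5"
    using max_Gamma_bounds[OF J(1) max] by blast+
  show "component_through ip (reduced_div (v ` J)) C = reduced_div (v ` ?\<Gamma>)"
    using component_eq_iff[OF J bounds] max Gamma_div_eq[OF bounds] by simp
  \<comment> \<open>Here the hypothesis \<open>ADER\<close> enters: for this triple
    \<open>max_Gamma\<close> puts all nine labels into \<open>J\<close>, and the whole fiber has no
    type.\<close>
  show "(\<alpha>, \<beta>, \<gamma>) \<noteq> (1, 2, 5)"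
  proof
    assume "(\<alpha>, \<beta>, \<gamma>) = (1, 2, 5)"
    then have triple: "\<alpha> = 1" "\<beta> = 2" "\<gamma> = 5" by simp_all
    have "\<alpha> \<noteq> 0 \<longrightarrow> 2 \<in> J" "\<beta> \<noteq> 0 \<longrightarrow> 3 \<in> J" "\<beta> = 2 \<longrightarrow> 1 \<in> J" "{4..4 + \<gamma>} \<subseteq> J"
      using max by (cases "1 \<in> J"; simp add: max_Gamma_def)+
    then have "1 \<in> J" "2 \<in> J" "3 \<in> J" "{4..9} \<subseteq> J"
      using triple by simp_all
    moreover have "{1..9} \<subseteq> insert 1 (insert 2 (insert 3 {4..9 :: nat}))" by auto
    ultimately have "{1..9} \<subseteq> J" by blast
    with J(1) have "J = {1..9}" by (rule equalityI)
    with ader whole_fiber_not_of_type show False unfolding ADER_def by blast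
  qed
  \<comment> \<open>If 3 is in \<open>J\<close>, then \<Gamma> absorbs 3 and also 1 if present;
    otherwise \<beta> = 0 and only label 1, the curve \<open>M 2\<close>, can remain.\<close>
  have "J \<inter> {1, 3} - ?\<Gamma> \<subseteq> (if \<beta> = 0 then {1} else {})"
    using max by (auto simp: max_Gamma_def Gamma_labels_def split: if_splits)
  then have "J \<inter> {1, 3} - ?\<Gamma> = {} \<or> \<beta> = 0 \<and> J \<inter> {1, 3} - ?\<Gamma> = {1}"
    by (auto split: if_splits)
  moreover have "reduced_div (v ` {1}) = prime_div (M 2)"
    by (simp add: reduced_div_def v_def)
  ultimately have "RM = 0 \<or> \<beta> = 0 \<and> RM = prime_div (M 2)"
    using RM by (metis image_empty reduced_div_empty)
  then show "\<beta> \<ge> 1 \<longrightarrow> RM = 0" "RM = 0 \<or> RM = prime_div (M 2)" by auto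
  \<comment> \<open>Back to indices on the L-branch. The tail starts at \<gamma> + 2 because
    \<open>L (\<gamma> + 1)\<close>, with label 5 + \<gamma>, is missing.\<close>
  define I where "I = {i \<in> {\<gamma> + 2..5}. i + 4 \<in> J}"
  have "J \<inter> {5..9} - ?\<Gamma> = (\<lambda>i. i + 4) ` I"
  proof (intro equalityI subsetI)
    fix i assume i: "i \<in> J \<inter> {5..9} - ?\<Gamma>"
    then have "i \<noteq> 5 + \<gamma>" using max by (auto simp: max_Gamma_def)
    with i show "i \<in> (\<lambda>i. i + 4) ` I"
      by (intro image_eqI[of _ _ "i - 4"]) (auto simp: I_def Gamma_labels_def)
  qed (auto simp: I_def Gamma_labels_def)
  then have "RL = reduced_div ((\<lambda>i. v (i + 4)) ` I)"
    unfolding RL by (simp add: image_image)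
  also have "(\<lambda>i. v (i + 4)) ` I = L ` I"
    by (rule image_cong) (auto simp: I_def v_def)
  finally have RL_I: "RL = reduced_div (L ` I)" .
  have I: "I \<subseteq> {\<gamma> + 2..5}" by (auto simp: I_def)
  show "\<gamma> \<le> 3 \<longrightarrow> union_of_subchains L (\<gamma> + 2) 5 RL"
    unfolding RL_I using L_tail[OF I] by blast
  show zero: "\<gamma> \<ge> 4 \<longrightarrow> RL = 0"
  proof
    assume "\<gamma> \<ge> 4"
    then have "I = {}" using I by auto
    then show "RL = 0" by (simp add: RL_I)
  qed
  show "RL \<noteq> 0 \<longrightarrow> bounded_A_type ip RL \<gamma>"
  proof
    assume "RL \<noteq> 0"
    with zero have "\<gamma> \<le> 3" by linarith
    then show "bounded_A_type ip RL \<gamma>" unfolding RL_I using L_tail[OF I] by blast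
  qed
qed

text \<open>\<Gamma> and the two tails each have a type and are pairwise non-adjacent, so their
  types concatenate. The type of \<open>RL\<close> comes from \<open>bounded_A_type\<close>, its
  position from \<open>union_of_subchains\<close>.\<close>

lemma ADER_of_decomposition:
  assumes red: "reduced_subdivisor F R" and R: "R = Gamma_div C S M L \<alpha> \<beta> \<gamma> + RM + RL"
    and bounds: "\<alpha> \<le> 1" "\<beta> \<le> 2" "\<gamma> \<le> 5" "(\<alpha>, \<beta>, \<gamma>) \<noteq> (1, 2, 5)"
    and RM: "RM = 0 \<or> \<beta> = 0 \<and> RM = prime_div (M 2)"
    and RL: "RL = 0 \<or> \<gamma> \<le> 3 \<and> union_of_subchains L (\<gamma> + 2) 5 RL \<and> bounded_A_type ip RL \<gamma>"
  shows "ADER ip F R"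
proof -
  let ?\<Gamma> = "Gamma_labels \<alpha> \<beta> \<gamma>"
  obtain J where J: "J \<subseteq> {1..9}" "R = reduced_div (v ` J)"
    using red unfolding reduced_subdivisor_iff by blast
  obtain t where \<Gamma>_type: "of_type ip (reduced_div (v ` ?\<Gamma>)) [t]"
    using Gamma_has_type[OF bounds] .
  have \<Gamma>_sub: "?\<Gamma> \<subseteq> {1..9}" using Gamma_labels_subset[OF bounds(3)] .
  \<comment> \<open>\<open>B\<close> holds the label of \<open>M 2\<close> or nothing. The clause
    linking it to \<beta> = 0 is kept since it excludes an edge to \<open>M 1\<close>.\<close>
  obtain B ms where B: "RM = reduced_div (v ` B)" "B \<subseteq> {1}" "B = {} \<or> \<beta> = 0" "of_type ip RM ms"
  proof (cases "RM = 0")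
    case True
    with of_type_zero[of ip] show thesis by (intro that[of "{}" "[]"]) auto
  next
    case False
    then show thesis using RM M2_type that[of "{1}" "[DynA 1]"] by (simp add: reduced_div_def v_def)
  qed
  obtain ls where ls: "of_type ip RL ls"
    using RL of_type_zero unfolding bounded_A_type_def by metis
  have Supp_RL: "Supp RL \<subseteq> v ` {6 + \<gamma>..9}"
    using RL
  proof
    assume "\<gamma> \<le> 3 \<and> union_of_subchains L (\<gamma> + 2) 5 RL \<and> bounded_A_type ip RL \<gamma>"
    then have "Supp RL \<subseteq> L ` {\<gamma> + 2..5}" using Supp_union_of_subchains by blast
    also have "\<dots> = (\<lambda>i. v (i + 4)) ` {\<gamma> + 2..5}" by (rule image_cong) (auto simp: v_def)
    also have "\<dots> = v ` (\<lambda>i. i + 4) ` {\<gamma> + 2..5}" by (simp only: image_image)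
    finally show ?thesis by (simp add: add.commute)
  qed simp
  define A where "A = J \<inter> {6 + \<gamma>..9}"
  have A: "A \<subseteq> {1..9}" "B \<subseteq> {1..9}" using J B by (auto simp: A_def)
  \<comment> \<open>From label 6 + \<gamma> on, \<Gamma> and \<open>B\<close> contribute nothing, so
    \<open>RL\<close> has the coefficients of the reduced divisor \<open>R\<close>. Elsewhere both
    sides vanish.\<close>
  have "Poly_Mapping.lookup RL X = Poly_Mapping.lookup (reduced_div (v ` A)) X" for X
  proof (cases "X \<in> v ` {6 + \<gamma>..9}")
    case True
    then obtain i where i: "X = v i" "i \<in> {6 + \<gamma>..9}" by blast
    then have "i \<in> {1..9}" "i \<notin> ?\<Gamma>" "i \<notin> B" using B by (auto simp: Gamma_labels_def)
    moreover have "Poly_Mapping.lookup R X = Poly_Mapping.lookup (reduced_div (v ` ?\<Gamma>)) X +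
        Poly_Mapping.lookup (reduced_div (v ` B)) X + Poly_Mapping.lookup RL X"
      using R B(1) Gamma_div_eq[OF bounds(1-3)] by (simp add: lookup_add)
    ultimately show ?thesis
      using i A \<Gamma>_sub J by (simp add: lookup_v A_def)
  next
    case False
    then have "X \<notin> Supp RL" "X \<notin> v ` A" using Supp_RL by (auto simp: A_def)
    then show ?thesis using A by (simp add: in_keys_iff lookup_reduced_div finite_index)
  qed
  then have RL_A: "RL = reduced_div (v ` A)" by (rule poly_mapping_eqI)
  have join: "of_type ip (reduced_div (v ` (P \<union> Q))) (ps @ qs) \<and>
      reduced_div (v ` (P \<union> Q)) = reduced_div (v ` P) + reduced_div (v ` Q)"
    if "of_type ip (reduced_div (v ` P)) ps" "of_type ip (reduced_div (v ` Q)) qs"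
      "P \<subseteq> {1..9}" "Q \<subseteq> {1..9}" "P \<inter> Q = {}"
      and na: "\<And>i j. \<lbrakk>i \<in> P; j \<in> Q\<rbrakk> \<Longrightarrow> \<not> adj i j \<and> \<not> adj j i" for P Q ps qs
  proof -
    have disj: "v ` P \<inter> v ` Q = {}"
      using inj_on_image_Int[OF inj_v that(3,4)] that(5) by simp
    have "ip X Y = 0 \<and> ip Y X = 0" if XY: "X \<in> v ` P" "Y \<in> v ` Q" for X Y
    proof -
      obtain i j where ij: "X = v i" "Y = v j" "i \<in> P" "j \<in> Q" using XY by blast
      then have "i \<in> {1..9}" "j \<in> {1..9}" "i \<noteq> j"
        using \<open>P \<subseteq> {1..9}\<close> \<open>Q \<subseteq> {1..9}\<close> \<open>P \<inter> Q = {}\<close> by blast+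
      then show ?thesis using na[OF ij(3,4)] ip_v[of i j] ip_sym[of i j] ij by simp
    qed
    then have "of_type ip (reduced_div (v ` P \<union> v ` Q)) (ps @ qs)"
      using that(1-4) disj by (intro of_type_Un finite_index) auto
    then show ?thesis
      using that(3,4) disj by (simp add: image_Un reduced_div_Un finite_index)
  qed
  \<comment> \<open>Label 1 is adjacent only to 3, which is outside \<Gamma> for \<beta> = 0.
    Likewise \<open>A\<close> starts at 6 + \<gamma>, two steps beyond the last label 4 + \<gamma>
    of \<Gamma>.\<close>
  have "of_type ip (reduced_div (v ` (?\<Gamma> \<union> B))) ([t] @ ms) \<and>
      reduced_div (v ` (?\<Gamma> \<union> B)) = reduced_div (v ` ?\<Gamma>) + reduced_div (v ` B)"
    by (rule join) (use \<Gamma>_type B \<Gamma>_sub A in \<open>auto simp: Gamma_labels_def adj_def\<close>)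
  moreover from this have "of_type ip (reduced_div (v ` (?\<Gamma> \<union> B \<union> A))) (([t] @ ms) @ ls) \<and>
      reduced_div (v ` (?\<Gamma> \<union> B \<union> A)) = reduced_div (v ` (?\<Gamma> \<union> B)) + reduced_div (v ` A)"
    by (intro join) (use ls RL_A B \<Gamma>_sub A in \<open>auto simp: Gamma_labels_def adj_def A_def\<close>)
  ultimately have "of_type ip R (([t] @ ms) @ ls)"
    using R B(1) RL_A Gamma_div_eq[OF bounds(1-3)] by metis
  with red show ?thesis unfolding ADER_def by blast
qed

end

theorem proposition12p2:
  fixes ip :: "'c \<Rightarrow> 'c \<Rightarrow> int" and F :: "'c divisor"
    and C :: 'c and S M L :: "nat \<Rightarrow> 'c"
  assumes fiber: "fiber_II_star ip F C S M L"
  shows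
    "(\<forall>R. ADER ip F R \<and> C \<in> Supp R \<longrightarrow>
        (\<exists>!(\<alpha>, \<beta>, \<gamma>, RM, RL). ader_decomposition ip C S M L R \<alpha> \<beta> \<gamma> RM RL) \<and>
        (\<forall>\<alpha> \<beta> \<gamma> RM RL \<Gamma>.
           ader_decomposition ip C S M L R \<alpha> \<beta> \<gamma> RM RL \<and> \<Gamma> = component_through ip R C \<longrightarrow>
           ((\<alpha> = 0 \<or> \<beta> = 0 \<or> \<gamma> = 0) \<and> of_type ip \<Gamma> [DynA (1 + \<alpha> + \<beta> + \<gamma>)]
            \<or>
            \<alpha> \<noteq> 0 \<and> \<beta> \<noteq> 0 \<and> \<gamma> \<noteq> 0 \<and> \<alpha> = 1 \<and> (\<beta>, \<gamma>) \<noteq> (2, 5) \<and>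
            (\<beta> = 1 \<longrightarrow> of_type ip \<Gamma> [DynD (\<gamma> + 3)]) \<and>
            ((\<beta>, \<gamma>) = (2, 1) \<longrightarrow> of_type ip \<Gamma> [DynD 5]) \<and>
            ((\<beta>, \<gamma>) = (2, 2) \<longrightarrow> of_type ip \<Gamma> [DynE6]) \<and>
            ((\<beta>, \<gamma>) = (2, 3) \<longrightarrow> of_type ip \<Gamma> [DynE7]) \<and>
            ((\<beta>, \<gamma>) = (2, 4) \<longrightarrow> of_type ip \<Gamma> [DynE8])) \<and>
           (\<beta> \<ge> 1 \<longrightarrow> RM = 0) \<and>
           (\<beta> = 0 \<longrightarrow> RM = 0 \<or> RM = prime_div (M 2) \<and> of_type ip RM [DynA 1]) \<and>
           (\<gamma> \<le> 3 \<longrightarrow> RL = 0 \<or> union_of_subchains L (\<gamma> + 2) 5 RL) \<and>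
           (\<gamma> \<ge> 4 \<longrightarrow> RL = 0) \<and>
           (RL \<noteq> 0 \<longrightarrow> bounded_A_type ip RL \<gamma>)))
     \<and>
     (\<forall>R \<alpha> \<beta> \<gamma> RM RL.
        reduced_subdivisor F R \<and>
        R = Gamma_div C S M L \<alpha> \<beta> \<gamma> + RM + RL \<and>
        \<alpha> \<in> {0, 1} \<and> \<beta> \<in> {0, 1, 2} \<and> \<gamma> \<in> {0, 1, 2, 3, 4, 5} \<and>
        (\<alpha>, \<beta>, \<gamma>) \<noteq> (1, 2, 5) \<and>
        (\<beta> \<ge> 1 \<longrightarrow> RM = 0) \<and>
        (\<beta> = 0 \<longrightarrow> RM \<in> {0, prime_div (M 2)}) \<and>
        (RL = 0 \<or>
         \<gamma> \<le> 3 \<and> union_of_subchains L (\<gamma> + 2) 5 RL \<and> bounded_A_type ip RL \<gamma>)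
        \<longrightarrow> ADER ip F R)"
proof -
  interpret II_star_fiber ip F C S M L by unfold_locales (rule fiber)
  show ?thesis
  proof ((rule conjI; intro allI impI), goal_cases)
    case (1 R)
    then obtain J where J: "J \<subseteq> {1..9}" and R: "R = reduced_div (v ` J)"
      unfolding ADER_def reduced_subdivisor_iff by blast
    with 1 have "v 4 \<in> v ` J" by (simp add: Supp_reduced_div finite_index v_4)
    then have 4: "4 \<in> J" using v_mem_image[OF _ J] by simp
    show ?case
    proof (rule conjI, goal_cases)
      case 1
      show ?case unfolding R by (rule ex1_ader_decomposition[OF J 4])
    next
      case 2
      show ?case
      proof (intro allI impI, goal_cases)
        case (1 \<alpha> \<beta> \<gamma> RM RL \<Gamma>)
        then have "ADER ip F (reduced_div (v ` J))"
          "ader_decomposition ip C S M L (reduced_div (v ` J)) \<alpha> \<beta> \<gamma> RM RL"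
          and \<Gamma>: "\<Gamma> = component_through ip (reduced_div (v ` J)) C"
          using \<open>ADER ip F R \<and> C \<in> Supp R\<close> R by blast+
        note props = decomposition_properties[OF J 4 this(1,2)]
        show ?case
          by (intro conjI Gamma_type[OF props(1-4) \<Gamma>[unfolded props(5)]])
            (use props(6-) M2_type in blast)+
      qed
    qed
  next
    case (2 R \<alpha> \<beta> \<gamma> RM RL)
    then have "\<alpha> \<in> {0, 1}" "\<beta> \<in> {0, 1, 2}" "\<gamma> \<in> {0, 1, 2, 3, 4, 5}"
      and RM: "\<beta> \<ge> 1 \<longrightarrow> RM = 0" "\<beta> = 0 \<longrightarrow> RM \<in> {0, prime_div (M 2)}" by blast+
    then have bounds: "\<alpha> \<le> 1" "\<beta> \<le> 2" "\<gamma> \<le> 5" by auto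
    have "RM = 0 \<or> \<beta> = 0 \<and> RM = prime_div (M 2)"
      using RM by (cases "\<beta> = 0") simp_all
    with 2 bounds show ?case
      by (intro ADER_of_decomposition[of R \<alpha> \<beta> \<gamma> RM RL]) blast+
  qed
qed

end
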